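(* Let $k\geq 1$ be an integer and $l=\binom{k+2}{3}$. Let $I\subset R=\mathbb{C}[x,y,z]$ be a $0$-dimensional Borel-fixed ideal of colength $l$, and let $x^{m_1},y^{m_2},z^{m_3}$ be the pure powers among its minimal monomial generators. If $[I]$ has the maximal singularity in $\mathrm{Hilb}^l(\mathbb{A}^3)$, i.e. $T(I)\geq T(J)$ for every ideal $J\subset R$ with $\dim_{\mathbb{C}}R/J=l$, then $m_1=k$.
   Context: Let $R=\mathbb{C}[x,y,z]$. An ideal $I\subset R$ is $0$-dimensional if $R/I$ is Artinian; its colength is $\dim_{\mathbb{C}}R/I$. For such $I$, $T(I)=\dim_{\mathbb{C}}\mathrm{Hom}_R(I,R/I)$ is the dimension of the tangent space to $\mathrm{Hilb}^l(\mathbb{A}^3)$ at the point $[I]$. A monomial ideal $I$ is called Borel-fixed if for every minimal monomial generator $g$ of $I$: if $z\mid g$ then $xg/z\in I$ and $yg/z\in I$; and if $y\mid g$ then $xg/y\in I$. For a Borel-fixed ideal the exponent $m_1$ is the smallest of the pure exponents $m_1,m_2,m_3$. *)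

theory Defs
  imports
    "HOL-Library.Poly_Mapping"
    "HOL-Library.Product_Plus"
    "HOL-Algebra.QuotRing"
    "Jordan_Normal_Form.VS_Connect"
begin

text \<open>
  The polynomial ring \<open>\<complex>[x,y,z]\<close> is the monoid algebra of the additive monoid
  \<open>\<nat>\<^sup>3\<close>: the key \<open>(a,b,c)\<close> stands for the monomial \<open>x\<^sup>a y\<^sup>b z\<^sup>c\<close>, and multiplication
  of finitely supported maps is convolution.
\<close>

type_synonym poly3 = "(nat \<times> nat \<times> nat) \<Rightarrow>\<^sub>0 complex"

abbreviation R3 :: "poly3 ring" where
  "R3 \<equiv> class_ring"

definition const3 :: "complex \<Rightarrow> poly3" where
  "const3 c = Poly_Mapping.single (0, 0, 0) c"

definition var_x :: poly3 where "var_x = Poly_Mapping.single (1, 0, 0) 1"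
definition var_y :: poly3 where "var_y = Poly_Mapping.single (0, 1, 0) 1"
definition var_z :: poly3 where "var_z = Poly_Mapping.single (0, 0, 1) 1"

definition monomials3 :: "poly3 set" where
  "monomials3 = {var_x ^ a * var_y ^ b * var_z ^ c | a b c. True}"


subsection \<open>Modules\<close>

text \<open>
  The multiplicative part of a \<^typ>\<open>('a, 'b) module\<close> record plays no role for modules.
  It is left \<^const>\<open>undefined\<close> below.
\<close>

definition ideal_module :: "('a, 'm) ring_scheme \<Rightarrow> 'a set \<Rightarrow> ('a, 'a) module" where
  "ideal_module R I = \<lparr>carrier = I, mult = undefined, one = undefined,
     zero = \<zero>\<^bsub>R\<^esub>, add = (\<oplus>\<^bsub>R\<^esub>), smult = (\<otimes>\<^bsub>R\<^esub>)\<rparr>"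

definition quot_module :: "('a, 'm) ring_scheme \<Rightarrow> 'a set \<Rightarrow> ('a, 'a set) module" where
  "quot_module R I = \<lparr>carrier = carrier (R Quot I), mult = undefined, one = undefined,
     zero = \<zero>\<^bsub>R Quot I\<^esub>, add = (\<oplus>\<^bsub>R Quot I\<^esub>),
     smult = (\<lambda>r A. (I +>\<^bsub>R\<^esub> r) \<otimes>\<^bsub>R Quot I\<^esub> A)\<rparr>"

text \<open>
  Homomorphisms are taken to be \<^const>\<open>extensional\<close>, as \<^const>\<open>LinearCombinations.module_hom\<close> does not
  constrain their values outside the carrier of the domain.
\<close>

definition Hom_module ::
  "('a, 'm) ring_scheme \<Rightarrow> ('a, 'b) module \<Rightarrow> ('a, 'c) module \<Rightarrow> ('a, 'b \<Rightarrow> 'c) module" where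
  "Hom_module R M N = \<lparr>carrier = LinearCombinations.module_hom R M N \<inter> extensional (carrier M),
     mult = undefined, one = undefined,
     zero = (\<lambda>x\<in>carrier M. \<zero>\<^bsub>N\<^esub>),
     add = (\<lambda>f g. \<lambda>x\<in>carrier M. f x \<oplus>\<^bsub>N\<^esub> g x),
     smult = (\<lambda>r f. \<lambda>x\<in>carrier M. r \<odot>\<^bsub>N\<^esub> f x)\<rparr>"

text \<open>Restriction of scalars along \<open>\<complex> \<rightarrow> \<complex>[x,y,z]\<close>.\<close>

definition complex_space :: "(poly3, 'b) module \<Rightarrow> (complex, 'b) module" where
  "complex_space M = \<lparr>carrier = carrier M, mult = mult M, one = one M,
     zero = zero M, add = add M, smult = (\<lambda>c. smult M (const3 c))\<rparr>"

abbreviation fin_dim\<^sub>C :: "(complex, 'b) module \<Rightarrow> bool" where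
  "fin_dim\<^sub>C V \<equiv> vectorspace.fin_dim class_ring V"

abbreviation dim\<^sub>C :: "(complex, 'b) module \<Rightarrow> nat" where
  "dim\<^sub>C V \<equiv> vectorspace.dim class_ring V"


subsection \<open>Ideals\<close>

text \<open>
  \<^const>\<open>vectorspace.dim\<close> is a number even for an infinite-dimensional space (an
  unspecified one), so finiteness of the dimension is a separate conjunct.
\<close>

definition has_colength :: "poly3 set \<Rightarrow> nat \<Rightarrow> bool" where
  "has_colength I l \<longleftrightarrow>
     fin_dim\<^sub>C (complex_space (quot_module R3 I)) \<and>
     dim\<^sub>C (complex_space (quot_module R3 I)) = l"

definition artinian :: "('a, 'm) ring_scheme \<Rightarrow> bool" where
  "artinian R \<longleftrightarrow> ring R \<and>
     (\<forall>J :: nat \<Rightarrow> 'a set. (\<forall>n. ideal (J n) R \<and> J (Suc n) \<subseteq> J n) \<longrightarrow>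
        (\<exists>N. \<forall>n\<ge>N. J n = J N))"

definition zero_dimensional :: "poly3 set \<Rightarrow> bool" where
  "zero_dimensional I \<longleftrightarrow> ideal I R3 \<and> artinian (R3 Quot I)"

definition tangent_dim :: "poly3 set \<Rightarrow> nat" where
  "tangent_dim I =
     dim\<^sub>C (complex_space (Hom_module R3 (ideal_module R3 I) (quot_module R3 I)))"

definition monomial_ideal :: "poly3 set \<Rightarrow> bool" where
  "monomial_ideal I \<longleftrightarrow> (\<exists>S \<subseteq> monomials3. I = Idl\<^bsub>R3\<^esub> S)"

definition min_gens :: "poly3 set \<Rightarrow> poly3 set" where
  "min_gens I =
     {g \<in> monomials3 \<inter> I. \<forall>h \<in> monomials3 \<inter> I. h dvd g \<longrightarrow> h = g}"

text \<open>Here \<open>q\<close> is the quotient \<open>g / z\<close>, respectively \<open>g / y\<close>.\<close>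

definition borel_fixed :: "poly3 set \<Rightarrow> bool" where
  "borel_fixed I \<longleftrightarrow> monomial_ideal I \<and>
     (\<forall>g \<in> min_gens I.
        (\<forall>q. g = var_z * q \<longrightarrow> var_x * q \<in> I \<and> var_y * q \<in> I) \<and>
        (\<forall>q. g = var_y * q \<longrightarrow> var_x * q \<in> I))"


subsection \<open>The dimensions above are those of actual vector spaces\<close>

lemma (in ideal) quot_module_module:
  assumes "cring R"
  shows "Module.module R (quot_module R I)"
proof -
  interpret cring R by fact
  interpret Q: cring "R Quot I" by (rule quotient_is_cring[OF assms])
  have [simp]: "I +> r \<in> carrier (R Quot I)" if "r \<in> carrier R" for r
    using that by (rule ring_hom_closed[OF rcos_ring_hom])
  note h = ring_hom_mult[OF rcos_ring_hom] ring_hom_add[OF rcos_ring_hom]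
    ring_hom_one[OF rcos_ring_hom]
  have ag: "abelian_group (quot_module R I)"
  proof (rule abelian_groupI, goal_cases)
    case (6 A)
    then show ?case
      by (intro bexI[of _ "\<ominus>\<^bsub>R Quot I\<^esub> A"]) (auto simp: quot_module_def Q.l_neg)
  qed (simp_all add: quot_module_def Q.a_assoc, simp add: Q.a_comm)
  show ?thesis
    by (rule Module.moduleI)
      (use ag in \<open>auto simp: assms quot_module_def h Q.l_distr Q.r_distr Q.m_assoc\<close>)
qed

lemma (in ideal) ideal_module_module:
  assumes "cring R"
  shows "Module.module R (ideal_module R I)"
proof -
  interpret cring R by fact
  have "abelian_group (ideal_module R I)"
  proof (rule abelian_groupI, goal_cases)
    case (6 a)
    then show ?case
      by (intro bexI[of _ "\<ominus> a"]) (auto simp: ideal_module_def l_neg a_Hcarr)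
  qed (simp_all add: ideal_module_def a_assoc a_Hcarr, simp add: a_comm a_Hcarr)
  then show ?thesis
    by (intro Module.moduleI)
      (auto simp: assms ideal_module_def I_l_closed l_distr r_distr m_assoc)
qed

lemma Hom_module_module:
  assumes "Module.module R M" "Module.module R N"
  shows "Module.module R (Hom_module R M N)"
proof -
  interpret M: Module.module R M by fact
  interpret N: Module.module R N by fact
  note H = Hom_module_def LinearCombinations.module_hom_def Pi_iff
  have "abelian_group (Hom_module R M N)"
  proof (rule abelian_groupI, goal_cases)
    case (6 f)
    have "(\<lambda>x\<in>carrier M. \<ominus>\<^bsub>N\<^esub> f x) \<in> carrier (Hom_module R M N)"
      using 6 by (auto simp: H N.minus_add N.smult_r_minus)
    then show ?case
      using 6
      by (intro bexI[of _ "\<lambda>x\<in>carrier M. \<ominus>\<^bsub>N\<^esub> f x"])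
        (auto simp: H fun_eq_iff restrict_def N.l_neg)
  qed (auto simp: H fun_eq_iff restrict_def extensional_def N.a_ac N.smult_r_distr)
  then show ?thesis
    by (intro Module.moduleI)
      (auto simp: H fun_eq_iff restrict_def extensional_def N.smult_r_distr N.smult_l_distr
        N.smult_assoc1[symmetric] M.R.m_comm M.R.cring_axioms)
qed

lemma const3_simps:
  "const3 1 = 1"
  "const3 (a + b) = const3 a + const3 b"
  "const3 (a * b) = const3 a * const3 b"
  by (simp_all add: const3_def single_add mult_single zero_prod_def[symmetric])

lemma vectorspace_complex_space:
  assumes "Module.module R3 M"
  shows "vectorspace class_ring (complex_space M)"
proof -
  interpret M: Module.module R3 M by fact
  have "abelian_group (complex_space M)"
  proof (rule abelian_groupI, goal_cases)
    case (6 a)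
    then show ?case
      by (intro bexI[of _ "\<ominus>\<^bsub>M\<^esub> a"]) (auto simp: complex_space_def M.l_neg)
  qed (simp_all add: complex_space_def M.a_assoc, simp add: M.a_comm)
  moreover have "cring (class_ring::complex ring)" "field (class_ring::complex ring)"
    using class_cring.cring_axioms class_field.field_axioms by simp_all
  moreover have "Module.module class_ring (complex_space M)"
    using calculation(1,2)
     M.smult_l_distr M.smult_r_distr M.smult_assoc1 M.smult_one M.smult_closed
    by (intro Module.moduleI) (auto simp: complex_space_def const3_simps)
  ultimately show ?thesis by (simp add: vectorspace_def)
qed

lemma vectorspace_quotient_and_Hom:
  assumes "ideal I R3"
  shows "vectorspace class_ring (complex_space (quot_module R3 I))"
    "vectorspace class_ring
      (complex_space (Hom_module R3 (ideal_module R3 I) (quot_module R3 I)))"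
proof -
  have c: "cring R3" by (rule class_cring.cring_axioms)
  note quot = ideal.quot_module_module[OF assms c]
  show "vectorspace class_ring (complex_space (quot_module R3 I))"
    by (rule vectorspace_complex_space[OF quot])
  show "vectorspace class_ring
      (complex_space (Hom_module R3 (ideal_module R3 I) (quot_module R3 I)))"
    by (rule vectorspace_complex_space[OF
          Hom_module_module[OF ideal.ideal_module_module[OF assms c] quot]])
qed

lemma monomial3_eq_single:
  "var_x ^ a * var_y ^ b * var_z ^ c = Poly_Mapping.single (a, b, c) 1"
proof -
  have "var_x ^ n = Poly_Mapping.single (n, 0, 0) 1" for n
    by (induction n) (auto simp: var_x_def mult_single zero_prod_def[symmetric])
  moreover have "var_y ^ n = Poly_Mapping.single (0, n, 0) 1" for n
    by (induction n) (auto simp: var_y_def mult_single zero_prod_def[symmetric])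
  moreover have "var_z ^ n = Poly_Mapping.single (0, 0, n) 1" for n
    by (induction n) (auto simp: var_z_def mult_single zero_prod_def[symmetric])
  ultimately show ?thesis by (simp add: mult_single)
qed

end

theory Submission
  imports Defs
begin

text \<open>
  Let \<open>m = m\<^sub>1\<close>. Cut \<open>I\<close> into the slices \<open>x\<^sup>i I\<^sub>i\<close> with \<open>I\<^sub>i \<subseteq> \<complex>[y,z]\<close> of colength \<open>l\<^sub>i\<close>. Haiman's arrow
  argument in each pair of slices shows that a homomorphism from \<open>I\<close> to \<open>R/I\<close> is determined by at most
  \<open>\<Sum> (2 l\<^sub>i + l\<^sub>j + l\<^sub>j\<^sub>+\<^sub>1 - 2 X\<^sub>i\<^sub>j)\<close> of its coefficients, summed over \<open>i \<le> j < m\<close>, where \<open>X\<^sub>i\<^sub>j\<close> counts the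
  monomials outside \<open>I\<^sub>i\<close> whose \<open>y\<close>-part lies in \<open>I\<^sub>j\<close>. As \<open>I\<close> is Borel-fixed, \<open>X\<^sub>i\<^sub>j\<close> is at least
  \<open>j - i + 1\<close> choose \<open>2\<close>, so that \<open>T(I) \<le> (2m + 1) l - 2 C(m + 2, 4)\<close>. This bound strictly increases in \<open>m\<close>
  for \<open>m \<le> k\<close>. At \<open>m = k\<close> it equals the dimension of the linear maps from the forms of degree \<open>k\<close> to those
  of degree \<open>k - 1\<close>, each of which is a homomorphism for the \<open>k\<close>-th power of the maximal ideal. Finally
  \<open>m \<le> k\<close>, since all monomials of degree less than \<open>m\<close> lie outside \<open>I\<close>.
\<close>

section \<open>Dimension counts by coordinates\<close>

text \<open>Independent sets of \<open>V\<close> map injectively onto independent sets of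
  \<open>W\<close>, so their size is at most \<open>W.dim\<close> and a maximal one is a finite
  basis.\<close>

lemma (in linear_map) inj_imp_dim_le:
  assumes inj: "inj_on T (carrier V)" and fin: "W.fin_dim"
  shows "V.fin_dim" "V.dim \<le> W.dim"
proof -
  have bound: "finite B \<and> card B \<le> W.dim" if B: "B \<subseteq> carrier V \<and> V.module.lin_indpt B" for B
  proof -
    have inj_B: "inj_on T B" using inj B by (blast intro: inj_on_subset)
    have img: "T ` B \<subseteq> carrier W" using B by auto
    have "W.module.lin_indpt (T ` B)"
    proof
      assume "W.module.lin_dep (T ` B)"
      then obtain C a w where C: "finite C" "C \<subseteq> T ` B" "a \<in> C \<rightarrow> carrier K"
        "W.module.lincomb a C = \<zero>\<^bsub>W\<^esub>" "w \<in> C" "a w \<noteq> \<zero>\<^bsub>K\<^esub>"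
        unfolding W.module.lin_dep_def by blast
      obtain D where D: "D \<subseteq> B" "C = T ` D" using C(2) by (meson subset_imageE)
      have fin_D: "finite D" using C(1) D inj_B by (meson finite_image_iff inj_on_subset)
      have "T (V.module.lincomb (a \<circ> T) D) = \<zero>\<^bsub>W\<^esub>"
        using lincomb_linear_image[OF inj, of D a] C D B fin_D by auto
      moreover have aT: "a \<circ> T \<in> D \<rightarrow> carrier K" using C(3) D by auto
      moreover have "V.module.lincomb (a \<circ> T) D \<in> carrier V"
        using D B aT by (intro V.module.lincomb_closed) auto
      ultimately have lc: "V.module.lincomb (a \<circ> T) D = \<zero>\<^bsub>V\<^esub>"
        using inj by (metis f0_is_0 inj_onD V.module.M.zero_closed)
      then have "V.module.lin_dep B"
      proof -
        obtain u where "u \<in> D" "w = T u" using C(5) D by blast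
        then show ?thesis
          unfolding V.module.lin_dep_def using fin_D aT C(6) D(1) lc
          by (intro exI[of _ D] exI[of _ "a \<circ> T"] exI[of _ u]) simp
      qed
      with B show False by blast
    qed
    then have "finite (T ` B)" "card (T ` B) \<le> W.dim"
      using W.li_le_dim[OF fin img] by auto
    then show ?thesis using inj_B by (simp add: card_image finite_image_iff)
  qed
  have "\<exists>B. finite B \<and> maximal B (\<lambda>S. S \<subseteq> carrier V \<and> V.module.lin_indpt S)"
    by (rule maximal_exists[OF bound, where B = "{}"]) (auto simp: V.module.lin_dep_def)
  then obtain B where B: "finite B" "V.basis B"
    using V.max_li_is_basis by blast
  then show "V.fin_dim" unfolding V.fin_dim_def V.basis_def by blast
  show "V.dim \<le> W.dim" using V.dim_basis[OF B] bound B(2) unfolding V.basis_def by simp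
qed

text \<open>Finitely many linear functionals \<open>L _ a\<close>. If they separate vectors they
  bound the dimension from above; if their values can be prescribed freely, from below.\<close>

locale coordinates = vectorspace class_ring V
  for V :: "(complex, 'v) module" +
  fixes L :: "'v \<Rightarrow> 'a \<Rightarrow> complex" and A :: "'a set"
  assumes finite_coords: "finite A"
    and coord_add: "\<And>v w a. \<lbrakk>v \<in> carrier V; w \<in> carrier V; a \<in> A\<rbrakk> \<Longrightarrow>
      L (v \<oplus>\<^bsub>V\<^esub> w) a = L v a + L w a"
    and coord_smult: "\<And>c v a. \<lbrakk>v \<in> carrier V; a \<in> A\<rbrakk> \<Longrightarrow> L (c \<odot>\<^bsub>V\<^esub> v) a = c * L v a"
begin

lemma coord_map:
  obtains T e where "linear_map class_ring V (module_vec TYPE(complex) (card A)) T"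
    "bij_betw e {..<card A} A" "\<And>v. T v = vec (card A) (\<lambda>i. L v (e i))"
proof -
  obtain e where e: "bij_betw e {..<card A} A"
    using ex_bij_betw_nat_finite[OF finite_coords] by (auto simp: lessThan_atLeast0)
  then have eA: "e i \<in> A" if "i < card A" for i
    using that by (auto simp: bij_betw_def)
  define T where "T v = vec (card A) (\<lambda>i. L v (e i))" for v
  have "linear_map class_ring V (module_vec TYPE(complex) (card A)) T"
  proof -
    have "mod_hom_axioms class_ring V (module_vec TYPE(complex) (card A)) T"
      by (auto simp: mod_hom_axioms_def LinearCombinations.module_hom_def T_def module_vec_def
          coord_add coord_smult eA)
    then show ?thesis
      using vectorspace_axioms vec_vs[where ?'a = complex]
      by (simp add: linear_map_def mod_hom_def vectorspace_def)
  qed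
  with e show thesis using that T_def by blast
qed

lemma dim_le_card:
  assumes "\<And>v. \<lbrakk>v \<in> carrier V; \<forall>a\<in>A. L v a = 0\<rbrakk> \<Longrightarrow> v = \<zero>\<^bsub>V\<^esub>"
  shows "fin_dim" "dim \<le> card A"
proof -
  obtain T e where Te: "linear_map class_ring V (module_vec TYPE(complex) (card A)) T"
    "bij_betw e {..<card A} A" "\<And>v. T v = vec (card A) (\<lambda>i. L v (e i))"
    using coord_map by blast
  interpret T: linear_map class_ring V "module_vec TYPE(complex) (card A)" T by fact
  interpret W: vec_space "TYPE(complex)" "card A" .
  have "T.ker \<subseteq> {\<zero>\<^bsub>V\<^esub>}"
  proof
    fix v assume "v \<in> T.ker"
    then have v: "v \<in> carrier V" "T v = 0\<^sub>v (card A)"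
      unfolding T.ker_def by (auto simp: module_vec_def)
    have "L v (e i) = 0" if "i < card A" for i
      using arg_cong[OF v(2), of "\<lambda>w. w $ i"] that by (simp add: Te(3))
    then have "\<forall>a\<in>A. L v a = 0"
      using Te(2) by (force simp: bij_betw_def)
    with assms v(1) show "v \<in> {\<zero>\<^bsub>V\<^esub>}" by blast
  qed
  then have "inj_on T (carrier V)"
    by (intro T.Ke0_imp_inj) (auto simp: T.ker_def)
  from T.inj_imp_dim_le[OF this W.fin_dim] show "fin_dim" "dim \<le> card A"
    by (simp_all add: W.dim_is_n)
qed

lemma card_le_dim:
  assumes "fin_dim" "\<And>g. \<exists>v\<in>carrier V. \<forall>a\<in>A. L v a = g a"
  shows "card A \<le> dim"
proof -
  obtain T e where Te: "linear_map class_ring V (module_vec TYPE(complex) (card A)) T"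
    "bij_betw e {..<card A} A" "\<And>v. T v = vec (card A) (\<lambda>i. L v (e i))"
    using coord_map by blast
  interpret T: linear_map class_ring V "module_vec TYPE(complex) (card A)" T by fact
  interpret W: vec_space "TYPE(complex)" "card A" .
  have "T ` carrier V = carrier (module_vec TYPE(complex) (card A))"
  proof (intro equalityI subsetI)
    fix w :: "complex vec" assume "w \<in> carrier (module_vec TYPE(complex) (card A))"
    then have w: "dim_vec w = card A" by (simp add: module_vec_def)
    obtain v where v: "v \<in> carrier V" "\<forall>a\<in>A. L v a = w $ the_inv_into {..<card A} e a"
      using assms(2) by meson
    have "T v = w"
    proof (rule eq_vecI)
      fix i assume "i < dim_vec w"
      with w have i: "i < card A" by simp
      with Te(2) have "the_inv_into {..<card A} e (e i) = i" "e i \<in> A"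
        by (auto simp: bij_betw_def intro: the_inv_into_f_f)
      with v(2) i show "T v $ i = w $ i" by (simp add: Te(3))
    qed (simp add: Te(3) w)
    with v(1) show "w \<in> T ` carrier V" by blast
  qed (auto simp: Te(3) module_vec_def)
  then have im: "T.im = carrier (module_vec TYPE(complex) (card A))"
    by (rule T.surj_imp_imT_carrier)
  \<comment> \<open>Rank-nullity speaks of the target with its carrier replaced by the image; as
    \<open>T\<close> is onto, that is the target itself.\<close>
  have "M\<lparr>carrier := carrier M\<rparr> = M" for M :: "(complex, complex vec) module" by simp
  with T.rank_nullity[OF assms(1)] have
    "vectorspace.dim class_ring (module_vec TYPE(complex) (card A)) \<le> dim"
    unfolding im by (metis le_add1)
  then show ?thesis using W.dim_is_n by simp
qed

end

section \<open>Monomial ideals and their quotients\<close>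

lemma lookup_single_times:
  fixes f :: "'a::cancel_comm_monoid_add \<Rightarrow>\<^sub>0 'b::semiring_0"
  shows "Poly_Mapping.lookup (Poly_Mapping.single e c * f) (e + v) = c * Poly_Mapping.lookup f v"
  by (simp add: lookup_mult lookup_single when_mult)

lemma lookup_single_times_eq_0:
  fixes f :: "'a::cancel_comm_monoid_add \<Rightarrow>\<^sub>0 'b::semiring_0"
  assumes "\<nexists>w. v = e + w"
  shows "Poly_Mapping.lookup (Poly_Mapping.single e c * f) v = 0"
proof -
  have "(Poly_Mapping.lookup f q when v = e + q) = 0" for q using assms by auto
  then show ?thesis by (simp add: lookup_mult lookup_single when_mult)
qed

lemma poly_mapping_eq_sum_single:
  "f = (\<Sum>u\<in>Poly_Mapping.keys f. Poly_Mapping.single u (Poly_Mapping.lookup f u))"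
  by (rule poly_mapping_eqI) (auto simp: lookup_sum lookup_single when_def in_keys_iff)

definition mono_ideal :: "(nat \<times> nat \<times> nat) set \<Rightarrow> poly3 set" where
  "mono_ideal E = {f. Poly_Mapping.keys f \<subseteq> E}"

lemma in_mono_ideal_iff: "f \<in> mono_ideal E \<longleftrightarrow> (\<forall>v. v \<notin> E \<longrightarrow> Poly_Mapping.lookup f v = 0)"
  by (auto simp: mono_ideal_def in_keys_iff)

lemma single_in_mono_ideal: "u \<in> E \<Longrightarrow> Poly_Mapping.single u c \<in> mono_ideal E"
  by (auto simp: in_mono_ideal_iff lookup_single when_def)

lemma ideal_R3I:
  assumes "0 \<in> J" "\<And>a b. \<lbrakk>a \<in> J; b \<in> J\<rbrakk> \<Longrightarrow> a + b \<in> J" "\<And>a r. a \<in> J \<Longrightarrow> r * a \<in> J"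
  shows "ideal J R3"
proof (rule idealI)
  show "ring R3" by (rule class_ring.ring_axioms)
  show "subgroup J (add_monoid R3)"
  proof (rule group.subgroupI[OF abelian_group.a_group[OF ring.is_abelian_group[OF class_ring.ring_axioms]]])
    fix a assume a: "a \<in> J"
    have "\<ominus>\<^bsub>R3\<^esub> a = - a" by (simp add: class_ring_simps)
    with assms(3)[OF a, of "-1"] show "inv\<^bsub>add_monoid R3\<^esub> a \<in> J"
      unfolding a_inv_def by (simp only: mult_minus1)
  qed (use assms in auto)
qed (use assms in \<open>auto simp: mult.commute\<close>)

lemma sum_in_ideal_R3:
  assumes "ideal J R3" "\<And>x. x \<in> X \<Longrightarrow> g x \<in> J"
  shows "(\<Sum>x\<in>X. g x) \<in> J"
proof -
  interpret ideal J R3 by fact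
  show ?thesis
    using assms(2) additive_subgroup.a_closed[OF additive_subgroup_axioms]
      additive_subgroup.zero_closed[OF additive_subgroup_axioms]
    by (induction X rule: infinite_finite_induct) auto
qed

locale monomial_exponents =
  fixes E :: "(nat \<times> nat \<times> nat) set"
  assumes up: "u \<in> E \<Longrightarrow> e + u \<in> E"
begin

abbreviation "I \<equiv> mono_ideal E"
abbreviation "Q \<equiv> quot_module R3 I"
abbreviation "H \<equiv> Hom_module R3 (ideal_module R3 I) Q"

lemma ideal_I: "ideal I R3"
proof (rule ideal_R3I)
  show "a + b \<in> I" if "a \<in> I" "b \<in> I" for a b
    using that by (auto simp: in_mono_ideal_iff lookup_add)
  fix a r assume "a \<in> I"
  then show "r * a \<in> I"
    unfolding mono_ideal_def using keys_mult[of r a] up by fastforce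
qed (simp add: mono_ideal_def)

sublocale ideal I R3 by (rule ideal_I)

text \<open>The representative is arbitrary, so the value is meaningful only outside
  \<open>E\<close>, where all representatives of a coset agree.\<close>

definition coef :: "poly3 set \<Rightarrow> nat \<times> nat \<times> nat \<Rightarrow> complex" where
  "coef A = Poly_Mapping.lookup (SOME f. A = I +>\<^bsub>R3\<^esub> f)"

lemma coset_eq_iff: "I +>\<^bsub>R3\<^esub> f = I +>\<^bsub>R3\<^esub> g \<longleftrightarrow> f - g \<in> I"
  using ring.quotient_eq_iff_same_a_r_cos[OF class_ring.ring_axioms ideal_I, of f g]
  by (simp add: class_ring_simps)

lemma carrier_Q: "carrier Q = range (\<lambda>f. I +>\<^bsub>R3\<^esub> f)"
  by (auto simp: quot_module_def FactRing_def A_RCOSETS_def')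

lemma zero_Q: "\<zero>\<^bsub>Q\<^esub> = I +>\<^bsub>R3\<^esub> 0"
  using a_rcos_const[of 0] additive_subgroup.zero_closed[OF additive_subgroup_axioms]
  by (simp add: quot_module_def FactRing_def)

lemma add_Q: "(I +>\<^bsub>R3\<^esub> f) \<oplus>\<^bsub>Q\<^esub> (I +>\<^bsub>R3\<^esub> g) = I +>\<^bsub>R3\<^esub> (f + g)"
  using ring_hom_add[OF rcos_ring_hom, of f g] by (simp add: quot_module_def)

lemma smult_Q: "r \<odot>\<^bsub>Q\<^esub> (I +>\<^bsub>R3\<^esub> f) = I +>\<^bsub>R3\<^esub> (r * f)"
  using ring_hom_mult[OF rcos_ring_hom, of r f] by (simp add: quot_module_def)

lemma coef_coset: "v \<notin> E \<Longrightarrow> coef (I +>\<^bsub>R3\<^esub> f) v = Poly_Mapping.lookup f v"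
proof -
  assume v: "v \<notin> E"
  have "I +>\<^bsub>R3\<^esub> f = I +>\<^bsub>R3\<^esub> (SOME g. I +>\<^bsub>R3\<^esub> f = I +>\<^bsub>R3\<^esub> g)"
    by (rule someI) (rule refl)
  then have "f - (SOME g. I +>\<^bsub>R3\<^esub> f = I +>\<^bsub>R3\<^esub> g) \<in> I" unfolding coset_eq_iff .
  with v show ?thesis unfolding coef_def in_mono_ideal_iff lookup_minus by (metis eq_iff_diff_eq_0)
qed

lemma coef_eq_0_imp_zero:
  assumes "A \<in> carrier Q" "\<And>v. v \<notin> E \<Longrightarrow> coef A v = 0"
  shows "A = \<zero>\<^bsub>Q\<^esub>"
proof -
  obtain f where f: "A = I +>\<^bsub>R3\<^esub> f" using assms(1) by (auto simp: carrier_Q)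
  with assms(2) show ?thesis
    by (auto simp: zero_Q coset_eq_iff in_mono_ideal_iff coef_coset)
qed

lemma coef_linear:
  assumes "A \<in> carrier Q" "B \<in> carrier Q" "v \<notin> E"
  shows "coef (A \<oplus>\<^bsub>Q\<^esub> B) v = coef A v + coef B v"
    and "coef (const3 c \<odot>\<^bsub>Q\<^esub> A) v = c * coef A v"
proof -
  have "Poly_Mapping.lookup (const3 c * f) v = c * Poly_Mapping.lookup f v" for f
    using lookup_single_times[of 0 c f v] by (simp add: const3_def zero_prod_def[symmetric])
  then show "coef (A \<oplus>\<^bsub>Q\<^esub> B) v = coef A v + coef B v"
    and "coef (const3 c \<odot>\<^bsub>Q\<^esub> A) v = c * coef A v"
    using assms by (auto simp: carrier_Q add_Q smult_Q coef_coset lookup_add)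
qed

text \<open>The coefficients at exponents outside \<open>E\<close> separate cosets and can be
  prescribed freely.\<close>

lemma has_colength_card:
  assumes "finite (- E)"
  shows "has_colength I (card (- E))"
proof -
  interpret coordinates "complex_space Q" coef "- E"
    using vectorspace_quotient_and_Hom(1)[OF ideal_I] assms
    by (auto simp: coordinates_def coordinates_axioms_def complex_space_def coef_linear)
  have fd: "fin_dim" "dim \<le> card (- E)"
    by (rule dim_le_card; auto simp: complex_space_def coef_eq_0_imp_zero)+
  moreover have "card (- E) \<le> dim"
  proof (rule card_le_dim[OF fd(1)])
    fix g :: "nat \<times> nat \<times> nat \<Rightarrow> complex"
    define f where "f = (\<Sum>v\<in>-E. Poly_Mapping.single v (g v))"
    have "Poly_Mapping.lookup f v = g v" if "v \<notin> E" for v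
      using assms that by (simp add: f_def lookup_sum lookup_single when_def)
    then show "\<exists>v\<in>carrier (complex_space Q). \<forall>a\<in>-E. coef v a = g a"
      by (intro bexI[of _ "I +>\<^bsub>R3\<^esub> f"]) (auto simp: coef_coset complex_space_def carrier_Q)
  qed
  ultimately show ?thesis by (simp add: has_colength_def)
qed

end

section \<open>Homomorphisms from a monomial ideal to its quotient\<close>

context monomial_exponents
begin

text \<open>
  A homomorphism \<open>\<phi>\<close> from \<open>I\<close> to \<open>R/I\<close> is encoded by \<open>c (u, v)\<close>, the coefficient of the monomial \<open>v\<close>
  in the image of the monomial \<open>u\<close>; only \<open>u \<in> E\<close> and \<open>v \<notin> E\<close> are meaningful.
\<close>

definition hom_table :: "((nat \<times> nat \<times> nat) \<times> (nat \<times> nat \<times> nat) \<Rightarrow> complex) \<Rightarrow> bool" where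
  "hom_table c \<longleftrightarrow>
     (\<forall>u\<in>E. \<forall>e v. e + v \<notin> E \<longrightarrow> c (e + u, e + v) = c (u, v)) \<and>
     (\<forall>u\<in>E. \<forall>e v. v \<notin> E \<longrightarrow> (\<nexists>w. v = e + w) \<longrightarrow> c (e + u, v) = 0)"

definition table :: "(poly3 \<Rightarrow> poly3 set) \<Rightarrow> (nat \<times> nat \<times> nat) \<times> (nat \<times> nat \<times> nat) \<Rightarrow> complex" where
  "table \<phi> = (\<lambda>(u, v). coef (\<phi> (Poly_Mapping.single u 1)) v)"

lemma H_simps:
  assumes "\<phi> \<in> carrier H"
  shows "f \<in> I \<Longrightarrow> \<phi> f \<in> carrier Q"
    and "\<lbrakk>f \<in> I; g \<in> I\<rbrakk> \<Longrightarrow> \<phi> (f + g) = \<phi> f \<oplus>\<^bsub>Q\<^esub> \<phi> g"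
    and "f \<in> I \<Longrightarrow> \<phi> (r * f) = r \<odot>\<^bsub>Q\<^esub> \<phi> f"
    and "\<phi> \<in> extensional I"
  using assms by (auto simp: Hom_module_def LinearCombinations.module_hom_def ideal_module_def)

text \<open>Both rules compare coefficients in \<phi>(x^e x^u) = x^e \<phi>(x^u): multiplication by
  x^e shifts exponents by \<open>e\<close> and has no term at an exponent not of the form
  \<open>e + w\<close>.\<close>

lemma hom_table_table:
  assumes "\<phi> \<in> carrier H"
  shows "hom_table (table \<phi>)"
proof -
  have shift: "\<exists>f. \<phi> (Poly_Mapping.single u 1) = I +>\<^bsub>R3\<^esub> f \<and>
      \<phi> (Poly_Mapping.single (e + u) 1) = I +>\<^bsub>R3\<^esub> (Poly_Mapping.single e 1 * f)"
    if u: "u \<in> E" for u e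
  proof -
    obtain f where f: "\<phi> (Poly_Mapping.single u 1) = I +>\<^bsub>R3\<^esub> f"
      using H_simps(1)[OF assms single_in_mono_ideal[OF u]] by (auto simp: carrier_Q)
    have "\<phi> (Poly_Mapping.single e 1 * Poly_Mapping.single u 1) =
        I +>\<^bsub>R3\<^esub> (Poly_Mapping.single e 1 * f)"
      by (simp add: H_simps(3)[OF assms single_in_mono_ideal[OF u]] f smult_Q)
    with f show ?thesis by (auto simp: mult_single)
  qed
  have "table \<phi> (e + u, e + v) = table \<phi> (u, v)" if "u \<in> E" "e + v \<notin> E" for u e v
  proof -
    have "v \<notin> E" using that(2) up by blast
    then show ?thesis
      using shift[OF that(1), of e] that(2) by (auto simp: table_def coef_coset lookup_single_times)
  qed
  moreover have "table \<phi> (e + u, v) = 0" if "u \<in> E" "v \<notin> E" "\<nexists>w. v = e + w" for u e v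
    using shift[OF that(1), of e] that(2,3) by (auto simp: table_def coef_coset lookup_single_times_eq_0)
  ultimately show ?thesis unfolding hom_table_def by blast
qed

text \<open>The monomials of \<open>I\<close> span it over the complex numbers, and extensionality
  fixes the map outside \<open>I\<close>.\<close>

lemma table_eq_0_imp_zero:
  assumes "\<phi> \<in> carrier H" "\<And>u v. \<lbrakk>u \<in> E; v \<notin> E\<rbrakk> \<Longrightarrow> table \<phi> (u, v) = 0"
  shows "\<phi> = \<zero>\<^bsub>H\<^esub>"
proof -
  interpret QM: Module.module R3 Q
    by (rule quot_module_module) (rule class_cring.cring_axioms)
  have gen: "\<phi> (Poly_Mapping.single u c) = \<zero>\<^bsub>Q\<^esub>" if u: "u \<in> E" for u c
  proof -
    have "\<phi> (Poly_Mapping.single u 1) = \<zero>\<^bsub>Q\<^esub>"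
      using assms(2)[OF u] H_simps(1)[OF assms(1) single_in_mono_ideal[OF u]]
      by (intro coef_eq_0_imp_zero) (auto simp: table_def)
    then have "\<phi> (Poly_Mapping.single 0 c * Poly_Mapping.single u 1) = \<zero>\<^bsub>Q\<^esub>"
      by (simp only: H_simps(3)[OF assms(1) single_in_mono_ideal[OF u]])
        (metis QM.smult_r_null UNIV_I partial_object.select_convs(1))
    then show ?thesis by (simp add: mult_single)
  qed
  have sum: "\<phi> (\<Sum>u\<in>X. Poly_Mapping.single u (h u)) = \<zero>\<^bsub>Q\<^esub> \<and> (\<Sum>u\<in>X. Poly_Mapping.single u (h u)) \<in> I"
    if "finite X" "X \<subseteq> E" for X h
    using that
  proof (induction X)
    case empty
    have "0 \<in> I" by (simp add: mono_ideal_def)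
    from H_simps(3)[OF assms(1) this, of 0] H_simps(1)[OF assms(1) this] this
    show ?case by (auto simp: carrier_Q smult_Q zero_Q)
  next
    case (insert u X)
    then have "Poly_Mapping.single u (h u) \<in> I" by (auto intro: single_in_mono_ideal)
    with insert gen[of u] H_simps(2)[OF assms(1)] show ?case
      by (auto simp: in_mono_ideal_iff lookup_add)
  qed
  have "\<phi> f = \<zero>\<^bsub>Q\<^esub>" if "f \<in> I" for f
    using sum[of "Poly_Mapping.keys f" "Poly_Mapping.lookup f"] that
    unfolding poly_mapping_eq_sum_single[of f, symmetric] by (simp add: mono_ideal_def)
  then show ?thesis
    using H_simps(4)[OF assms(1)]
    by (auto simp: Hom_module_def ideal_module_def extensional_def restrict_def fun_eq_iff)
qed

lemma coordinates_H:
  assumes "finite A" "A \<subseteq> E \<times> - E"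
  shows "coordinates (complex_space H) table A"
proof -
  have "table (\<phi> \<oplus>\<^bsub>H\<^esub> \<psi>) (u, v) = table \<phi> (u, v) + table \<psi> (u, v)"
    "table (const3 c \<odot>\<^bsub>H\<^esub> \<phi>) (u, v) = c * table \<phi> (u, v)"
    if "\<phi> \<in> carrier H" "\<psi> \<in> carrier H" "u \<in> E" "v \<notin> E" for \<phi> \<psi> c u v
    using that H_simps(1)[OF that(1), of "Poly_Mapping.single u 1"]
      H_simps(1)[OF that(2), of "Poly_Mapping.single u 1"] coef_linear
    by (auto simp: table_def Hom_module_def ideal_module_def single_in_mono_ideal)
  then show ?thesis
    using vectorspace_quotient_and_Hom(2)[OF ideal_I] assms
    by (intro coordinates.intro coordinates_axioms.intro) (auto simp: complex_space_def)
qed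

text \<open>Reduces upper bounds for T(I) to combinatorics: the rules of \<open>hom_table\<close>
  must propagate vanishing from \<open>A\<close> to all coefficients.\<close>

lemma tangent_dim_le:
  assumes "finite A" "A \<subseteq> E \<times> - E"
    and "\<And>c u v. \<lbrakk>hom_table c; \<forall>p\<in>A. c p = 0; u \<in> E; v \<notin> E\<rbrakk> \<Longrightarrow> c (u, v) = 0"
  shows "fin_dim\<^sub>C (complex_space H)" "tangent_dim I \<le> card A"
proof -
  interpret coordinates "complex_space H" table A
    by (rule coordinates_H) fact+
  have "\<phi> = \<zero>\<^bsub>complex_space H\<^esub>"
    if "\<phi> \<in> carrier (complex_space H)" "\<forall>p\<in>A. table \<phi> p = 0" for \<phi>
    using that table_eq_0_imp_zero[of \<phi>] assms(3)[OF hom_table_table[of \<phi>]]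
    by (simp add: complex_space_def)
  from dim_le_card[OF this] show "fin_dim\<^sub>C (complex_space H)" "tangent_dim I \<le> card A"
    unfolding tangent_dim_def by blast+
qed

text \<open>Each pair joins the exponent of a minimal generator to that of a socle monomial of R/I.
  Coefficients at such pairs are free, because monomials other than 1 annihilate the socle.\<close>

lemma card_le_tangent_dim:
  assumes "finite A" "A \<subseteq> E \<times> - E" "fin_dim\<^sub>C (complex_space H)"
    and min: "\<And>u v e w. \<lbrakk>(u, v) \<in> A; u = e + w; e \<noteq> 0\<rbrakk> \<Longrightarrow> w \<notin> E"
    and soc: "\<And>u v e. \<lbrakk>(u, v) \<in> A; e \<noteq> 0\<rbrakk> \<Longrightarrow> e + v \<in> E"
  shows "card A \<le> tangent_dim I"
proof -
  interpret coordinates "complex_space H" table A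
    by (rule coordinates_H) fact+
  \<comment> \<open>By minimality of \<open>u\<close>, a monomial other than 1 times an element of
    \<open>I\<close> has no term at \<open>u\<close>.\<close>
  have mult: "Poly_Mapping.lookup (r * f) u = Poly_Mapping.lookup r 0 * Poly_Mapping.lookup f u"
    if "(u, v) \<in> A" "f \<in> I" for u v r f
  proof -
    have *: "Poly_Mapping.lookup (Poly_Mapping.single e c * f) u = (c * Poly_Mapping.lookup f u when e = 0)" for e c
    proof (cases "e = 0 \<or> (\<nexists>w. u = e + w)")
      case True
      then show ?thesis
        using lookup_single_times[of 0 c f u] lookup_single_times_eq_0[of u e c f]
        by (auto simp: when_def)
    next
      case False
      then obtain w where w: "u = e + w" "e \<noteq> 0" by blast
      from min[OF that(1) w] that(2) have "Poly_Mapping.lookup f w = 0"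
        unfolding in_mono_ideal_iff by blast
      with w show ?thesis by (simp add: lookup_single_times)
    qed
    have "Poly_Mapping.lookup (r * f) u =
        (\<Sum>e\<in>Poly_Mapping.keys r. Poly_Mapping.lookup (Poly_Mapping.single e (Poly_Mapping.lookup r e) * f) u)"
      by (subst (1) poly_mapping_eq_sum_single[of r]) (simp add: sum_distrib_right lookup_sum)
    also have "\<dots> = Poly_Mapping.lookup r 0 * Poly_Mapping.lookup f u"
      by (simp add: * when_def in_keys_iff)
    finally show ?thesis .
  qed
  \<comment> \<open>Modulo \<open>I\<close>, only the constant term of \<open>r\<close> acts on the
    socle monomial.\<close>
  have socle: "r * Poly_Mapping.single v c - Poly_Mapping.single v (Poly_Mapping.lookup r 0 * c) \<in> I"
    if "(u, v) \<in> A" for u v r c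
  proof -
    have "Poly_Mapping.lookup (r * Poly_Mapping.single v c) w =
        Poly_Mapping.lookup (Poly_Mapping.single v (Poly_Mapping.lookup r 0 * c)) w" if w: "w \<notin> E" for w
    proof -
      have "Poly_Mapping.lookup (r * Poly_Mapping.single v c) w =
        (\<Sum>e\<in>Poly_Mapping.keys r. Poly_Mapping.lookup (Poly_Mapping.single (e + v) (Poly_Mapping.lookup r e * c)) w)"
        by (subst (1) poly_mapping_eq_sum_single[of r])
          (simp add: sum_distrib_right lookup_sum mult_single)
      also have "\<dots> = (\<Sum>e\<in>Poly_Mapping.keys r.
          if e = 0 then Poly_Mapping.lookup (Poly_Mapping.single v (Poly_Mapping.lookup r 0 * c)) w else 0)"
        using soc[OF \<open>(u, v) \<in> A\<close>] w by (intro sum.cong) (auto simp: lookup_single when_def)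
      finally show ?thesis by (simp add: in_keys_iff)
    qed
    then show ?thesis by (simp add: in_mono_ideal_iff lookup_minus)
  qed
  have "\<exists>\<phi>\<in>carrier (complex_space H). \<forall>p\<in>A. table \<phi> p = g p" for g
  proof -
    \<comment> \<open>\<open>F\<close> reads off the coefficients of \<open>f\<close> at generators
      and sends generator \<open>u\<close> to the \<open>g\<close>-weighted sum of its partners
      \<open>v\<close>. It is additive, and R-linear modulo \<open>I\<close> by \<open>mult\<close>
      and \<open>socle\<close>.\<close>
    define F where "F f = (\<Sum>(u, v)\<in>A. Poly_Mapping.single v (Poly_Mapping.lookup f u * g (u, v)))" for f :: poly3
    define \<phi> where "\<phi> = (\<lambda>f\<in>I. I +>\<^bsub>R3\<^esub> F f)"
    have F_add: "F (a + b) = F a + F b" for a b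
      by (simp add: F_def lookup_add distrib_right single_add case_prod_unfold sum.distrib)
    have F_mult: "I +>\<^bsub>R3\<^esub> F (r * f) = I +>\<^bsub>R3\<^esub> (r * F f)" if f: "f \<in> I" for r f
    proof -
      have "r * F f - F (r * f) = (\<Sum>(u, v)\<in>A. r * Poly_Mapping.single v (Poly_Mapping.lookup f u * g (u, v))
          - Poly_Mapping.single v (Poly_Mapping.lookup r 0 * (Poly_Mapping.lookup f u * g (u, v))))"
        unfolding F_def sum_distrib_left sum_subtractf[symmetric]
        by (intro sum.cong) (auto simp: mult[OF _ f] mult.assoc)
      also have "\<dots> \<in> I"
        by (rule sum_in_ideal_R3[OF ideal_I]) (auto intro: socle)
      finally show ?thesis by (simp add: coset_eq_iff[symmetric])
    qed
    have "\<phi> \<in> carrier H"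
      using F_add F_mult I_l_closed additive_subgroup.a_closed[OF additive_subgroup_axioms]
      by (auto simp: Hom_module_def LinearCombinations.module_hom_def ideal_module_def \<phi>_def
          carrier_Q add_Q smult_Q)
    moreover have "table \<phi> (u, v) = g (u, v)" if A: "(u, v) \<in> A" for u v
    proof -
      have "u \<in> E" "v \<notin> E" using A assms(2) by auto
      then have "table \<phi> (u, v) = Poly_Mapping.lookup (F (Poly_Mapping.single u 1)) v"
        by (simp add: table_def \<phi>_def single_in_mono_ideal coef_coset)
      also have "\<dots> = (\<Sum>p\<in>A. if p = (u, v) then g p else 0)"
      proof -
        have "Poly_Mapping.lookup (case p of (u', v') \<Rightarrow>
            Poly_Mapping.single v' (Poly_Mapping.lookup (Poly_Mapping.single u 1) u' * g (u', v'))) v =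
          (if p = (u, v) then g p else 0)" for p
          by (cases p) (auto simp: lookup_single when_def)
        then show ?thesis unfolding F_def lookup_sum by simp
      qed
      finally show ?thesis using A assms(1) by simp
    qed
    ultimately show ?thesis by (intro bexI[of _ \<phi>]) (auto simp: complex_space_def)
  qed
  from card_le_dim[OF assms(3) this] show ?thesis by (simp add: tangent_dim_def)
qed

end

section \<open>Sliding exponent pairs within slices\<close>

context monomial_exponents
begin

text \<open>The rules of \<open>hom_table\<close> for a single variable: both exponents move one
  step along an axis, or the coefficient vanishes since \<open>v\<close> is not divisible by that
  variable.\<close>

lemma hom_table_shift:
  assumes "hom_table c" "(i, a, s) \<in> E"
  shows "(Suc j, b, t) \<notin> E \<Longrightarrow> c ((Suc i, a, s), (Suc j, b, t)) = c ((i, a, s), (j, b, t))"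
    and "(j, Suc b, t) \<notin> E \<Longrightarrow> c ((i, Suc a, s), (j, Suc b, t)) = c ((i, a, s), (j, b, t))"
    and "(j, b, Suc t) \<notin> E \<Longrightarrow> c ((i, a, Suc s), (j, b, Suc t)) = c ((i, a, s), (j, b, t))"
    and "(0, b, t) \<notin> E \<Longrightarrow> c ((Suc i, a, s), (0, b, t)) = 0"
    and "(j, 0, t) \<notin> E \<Longrightarrow> c ((i, Suc a, s), (j, 0, t)) = 0"
    and "(j, b, 0) \<notin> E \<Longrightarrow> c ((i, a, Suc s), (j, b, 0)) = 0"
proof -
  have 1: "e + v \<notin> E \<Longrightarrow> c (e + (i, a, s), e + v) = c ((i, a, s), v)"
    and 2: "v \<notin> E \<Longrightarrow> \<nexists>w. v = e + w \<Longrightarrow> c (e + (i, a, s), v) = 0" for e v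
    using assms unfolding hom_table_def by blast+
  show "(Suc j, b, t) \<notin> E \<Longrightarrow> c ((Suc i, a, s), (Suc j, b, t)) = c ((i, a, s), (j, b, t))"
    "(0, b, t) \<notin> E \<Longrightarrow> c ((Suc i, a, s), (0, b, t)) = 0"
    using 1[of "(1, 0, 0)" "(j, b, t)"] 2[of "(0, b, t)" "(1, 0, 0)"] by auto
  show "(j, Suc b, t) \<notin> E \<Longrightarrow> c ((i, Suc a, s), (j, Suc b, t)) = c ((i, a, s), (j, b, t))"
    "(j, 0, t) \<notin> E \<Longrightarrow> c ((i, Suc a, s), (j, 0, t)) = 0"
    using 1[of "(0, 1, 0)" "(j, b, t)"] 2[of "(j, 0, t)" "(0, 1, 0)"] by auto
  show "(j, b, Suc t) \<notin> E \<Longrightarrow> c ((i, a, Suc s), (j, b, Suc t)) = c ((i, a, s), (j, b, t))"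
    "(j, b, 0) \<notin> E \<Longrightarrow> c ((i, a, Suc s), (j, b, 0)) = 0"
    using 1[of "(0, 0, 1)" "(j, b, t)"] 2[of "(j, b, 0)" "(0, 0, 1)"] by auto
qed

lemma up_mono:
  assumes "(i, a, s) \<in> E" "i \<le> i'" "a \<le> a'" "s \<le> s'"
  shows "(i', a', s') \<in> E"
  using up[OF assms(1), of "(i' - i, a' - a, s' - s)"] assms(2-4) by simp

end

locale artinian_exponents = monomial_exponents +
  assumes finite_compl: "finite (- E)"
begin

text \<open>\<open>wd\<close> and \<open>ht\<close> are the row lengths and column heights of the
  staircase outside \<open>E\<close> in slice \<open>i\<close>. Finiteness of \<open>- E\<close>
  makes the minima exist.\<close>

definition wd :: "nat \<Rightarrow> nat \<Rightarrow> nat" where "wd i t = (LEAST y. (i, y, t) \<in> E)"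
definition ht :: "nat \<Rightarrow> nat \<Rightarrow> nat" where "ht i a = (LEAST z. (i, a, z) \<in> E)"

lemma wd_le_iff: "wd i t \<le> y \<longleftrightarrow> (i, y, t) \<in> E"
proof -
  have "\<exists>y. (i, y, t) \<in> E"
  proof (rule ccontr)
    assume "\<nexists>y. (i, y, t) \<in> E"
    then have "range (\<lambda>y. (i, y, t)) \<subseteq> - E" by blast
    then have "finite (range (\<lambda>y::nat. (i, y, t)))" by (rule finite_subset) (rule finite_compl)
    moreover have "inj (\<lambda>y::nat. (i, y, t))" by (auto simp: inj_def)
    ultimately show False using range_inj_infinite by blast
  qed
  then have "(i, wd i t, t) \<in> E" unfolding wd_def by (rule LeastI_ex)
  then show ?thesis unfolding wd_def by (auto intro: up_mono Least_le)
qed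

lemma ht_le_iff: "ht i a \<le> z \<longleftrightarrow> (i, a, z) \<in> E"
proof -
  have "\<exists>z. (i, a, z) \<in> E"
  proof (rule ccontr)
    assume "\<nexists>z. (i, a, z) \<in> E"
    then have "range (\<lambda>z. (i, a, z)) \<subseteq> - E" by blast
    then have "finite (range (\<lambda>z::nat. (i, a, z)))" by (rule finite_subset) (rule finite_compl)
    moreover have "inj (\<lambda>z::nat. (i, a, z))" by (auto simp: inj_def)
    ultimately show False using range_inj_infinite by blast
  qed
  then have "(i, a, ht i a) \<in> E" unfolding ht_def by (rule LeastI_ex)
  then show ?thesis unfolding ht_def by (auto intro: up_mono Least_le)
qed

text \<open>Multiply by y until \<open>v\<close> ends its row; then divide by z unless
  \<open>u\<close> is at the bottom of its column. Division at \<open>t = 0\<close> gives zero.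
  Going down can lengthen the row, hence the nested induction on \<open>t\<close> and on the rest of
  the row. Both moves preserve \<open>a \<le> b\<close>.\<close>

lemma slide_right_down:
  assumes c: "hom_table c"
    and base: "\<And>a b t. \<lbrakk>a \<le> b; (j, b, t) \<notin> E; (j, Suc b, t) \<in> E\<rbrakk> \<Longrightarrow> c ((i, a, ht i a), (j, b, t)) = 0"
  shows "\<lbrakk>a \<le> b; (i, a, s) \<in> E; (j, b, t) \<notin> E\<rbrakk> \<Longrightarrow> c ((i, a, s), (j, b, t)) = 0"
proof (induction t arbitrary: a b s rule: less_induct)
  case (less t)
  note outer = less.IH
  from less.prems show ?case
  proof (induction "wd j t - b" arbitrary: a b s rule: less_induct)
    case less
    show ?case
    proof (cases "(j, Suc b, t) \<in> E")
      case False
      have "wd j t - Suc b < wd j t - b" using less.prems(3) wd_le_iff[of j t b] by simp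
      moreover have "(i, Suc a, s) \<in> E" using less.prems(2) by (rule up_mono) auto
      ultimately have "c ((i, Suc a, s), (j, Suc b, t)) = 0" using less False by simp
      then show ?thesis using hom_table_shift(2)[OF c less.prems(2) False] by simp
    next
      case True
      show ?thesis
      proof (cases "s = ht i a")
        case eq: True
        with base[OF less.prems(1,3) True] show ?thesis by simp
      next
        case False
        then obtain r where r: "s = Suc r" "(i, a, r) \<in> E"
          using less.prems(2) ht_le_iff by (metis le_Suc_eq old.nat.exhaust le_zero_eq)
        show ?thesis
        proof (cases t)
          case 0
          with less.prems(3) r show ?thesis using hom_table_shift(6)[OF c r(2)] by simp
        next
          case (Suc t')
          with less.prems(3) have "(j, b, t') \<notin> E" using up_mono by (metis le_refl lessI less_imp_le)
          with Suc r less.prems(1,3) outer[of t' a b r] hom_table_shift(3)[OF c r(2)]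
          show ?thesis by simp
        qed
      qed
    qed
  qed
qed

text \<open>Divide by y while \<open>u\<close> stays in \<open>E\<close>, which gives zero at
  \<open>b = 0\<close>; otherwise multiply by z until \<open>v\<close> tops its column. The first
  move lowers \<open>b\<close>, the second shortens the rest of the column.\<close>

lemma slide_left_up:
  assumes c: "hom_table c"
    and base: "\<And>a b s t. \<lbrakk>b \<le> a; (i, a, s) \<notin> E; (i, Suc a, s) \<in> E; (j, b, t) \<notin> E; (j, b, Suc t) \<in> E\<rbrakk>
      \<Longrightarrow> c ((i, Suc a, s), (j, b, t)) = 0"
  shows "\<lbrakk>b < a; (i, a, s) \<in> E; (j, b, t) \<notin> E\<rbrakk> \<Longrightarrow> c ((i, a, s), (j, b, t)) = 0"
proof (induction b arbitrary: a s t rule: less_induct)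
  case (less b)
  note outer = less.IH
  from less.prems show ?case
  proof (induction "ht j b - t" arbitrary: a s t rule: less_induct)
    case less
    then obtain a' where a': "a = Suc a'" "b \<le> a'" by (cases a) auto
    show ?case
    proof (cases "(i, a', s) \<in> E")
      case True
      show ?thesis
      proof (cases b)
        case 0
        with less.prems(3) a' show ?thesis using hom_table_shift(5)[OF c True] by simp
      next
        case (Suc b')
        with less.prems(3) have "(j, b', t) \<notin> E" using up_mono by (metis le_refl lessI less_imp_le)
        with Suc a' less.prems(3) True outer[of b' a' s t] hom_table_shift(2)[OF c True]
        show ?thesis by simp
      qed
    next
      case left: False
      show ?thesis
      proof (cases "(j, b, Suc t) \<in> E")
        case True
        with base[OF a'(2) left] a' less.prems show ?thesis by simp
      next
        case False
        have "ht j b - Suc t < ht j b - t" using less.prems(3) ht_le_iff[of j b t] by simp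
        moreover have "(i, a, Suc s) \<in> E" using less.prems(2) by (rule up_mono) auto
        ultimately have "c ((i, a, Suc s), (j, b, Suc t)) = 0" using less False by simp
        then show ?thesis using hom_table_shift(3)[OF c less.prems(2) False] by simp
      qed
    qed
  qed
qed

definition cells :: "nat \<Rightarrow> (nat \<times> nat) set" where
  "cells i = {(y, z). (i, y, z) \<notin> E}"

text \<open>The columns in which slice \<open>j\<close> has no cells. The second coordinate is free,
  so that the set can be compared with the cells of any slice.\<close>

definition beyond :: "nat \<Rightarrow> (nat \<times> nat) set" where
  "beyond j = {(y, z). (j, y, 0) \<in> E}"

text \<open>The index joins a column of the source slice to a row of the target slice, so one cell
  labels each pair. The subtraction of 1 is genuine when row \<open>t\<close> is nonempty.\<close>

definition row_pair :: "nat \<Rightarrow> nat \<Rightarrow> nat \<times> nat \<Rightarrow> (nat \<times> nat \<times> nat) \<times> (nat \<times> nat \<times> nat)" where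
  "row_pair i j = (\<lambda>(a, t). ((i, a, ht i a), (j, wd j t - 1, t)))"

definition column_pair :: "nat \<Rightarrow> nat \<Rightarrow> nat \<times> nat \<Rightarrow> (nat \<times> nat \<times> nat) \<times> (nat \<times> nat \<times> nat)" where
  "column_pair i j = (\<lambda>(b, s). ((i, wd i s, s), (j, b, ht j b - 1)))"

text \<open>
  The values of a homomorphism on the pairs below determine it. For the slices \<open>x\<^sup>i\<close> of the source
  and \<open>x\<^sup>j\<close> of the target, a pair whose \<open>y\<close>-exponent does not decrease can be moved right and down
  until \<open>v\<close> ends its row and \<open>u\<close> is at the bottom of its column (\<open>row_pair\<close>); any other pair can be
  moved left and up until \<open>u\<close> starts its row and \<open>v\<close> is at the top of its column (\<open>column_pair\<close>).
  The source slice \<open>Suc j\<close> above a target slice \<open>i \<le> j\<close> needs no row pairs beyond slice \<open>j\<close>: there \<open>u\<close>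
  is divisible by \<open>x\<close> within \<open>I\<close>, so both exponents can be moved one slice down, or \<open>v\<close> leaves slice \<open>0\<close>.
\<close>

definition test_pairs :: "nat \<Rightarrow> ((nat \<times> nat \<times> nat) \<times> (nat \<times> nat \<times> nat)) set" where
  "test_pairs m = (\<Union>j<m. \<Union>i\<le>j.
     (row_pair i j ` cells j \<union> column_pair i j ` (cells i - beyond j)) \<union>
     (row_pair (Suc j) i ` (cells i - beyond j) \<union> column_pair (Suc j) i ` cells (Suc j)))"

text \<open>At an end position of \<open>slide_right_down\<close>, the cell \<open>(b, t)\<close>
  and \<open>a \<le> b\<close> put \<open>(a, t)\<close> among the cells of the target slice, so the
  pair is one of those known to vanish.\<close>

lemma row_pair_base:
  assumes "\<forall>p\<in>row_pair i j ` (cells j - B). c p = 0"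
    and "a \<le> b" "(j, b, t) \<notin> E" "(j, Suc b, t) \<in> E" "(a, t) \<notin> B"
  shows "c ((i, a, ht i a), (j, b, t)) = 0"
proof -
  have "wd j t = Suc b" using assms(3,4) wd_le_iff[of j t] by (metis le_SucE not_less_eq_eq le_antisym)
  moreover have "(a, t) \<in> cells j - B" using assms(2,3,5) up_mono by (auto simp: cells_def)
  then have "c (row_pair i j (a, t)) = 0" using assms(1) by blast
  ultimately show ?thesis by (simp add: row_pair_def)
qed

text \<open>Dually, the cell \<open>(a, s)\<close> and \<open>b \<le> a\<close> put
  \<open>(b, s)\<close> among the cells of the source slice.\<close>

lemma column_pair_base:
  assumes "\<forall>p\<in>column_pair i j ` (cells i - B). c p = 0"
    and "b \<le> a" "(i, a, s) \<notin> E" "(i, Suc a, s) \<in> E" "(j, b, t) \<notin> E" "(j, b, Suc t) \<in> E" "(b, s) \<notin> B"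
  shows "c ((i, Suc a, s), (j, b, t)) = 0"
proof -
  have "wd i s = Suc a" using assms(3,4) wd_le_iff[of i s] by (metis le_SucE not_less_eq_eq le_antisym)
  moreover have "ht j b = Suc t" using assms(5,6) ht_le_iff[of j b] by (metis le_SucE not_less_eq_eq le_antisym)
  moreover have "(b, s) \<in> cells i - B" using assms(2,3,7) up_mono by (auto simp: cells_def)
  then have "c (column_pair i j (b, s)) = 0" using assms(1) by blast
  ultimately show ?thesis by (simp add: column_pair_def)
qed

lemma test_pairs_determine:
  assumes c: "hom_table c" and vanish: "\<forall>p\<in>test_pairs m. c p = 0" and m: "(m, 0, 0) \<in> E"
    and "u \<in> E" "v \<notin> E"
  shows "c (u, v) = 0"
proof -
  have lower: "c ((i, a, s), (j, b, t)) = 0"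
    if "i \<le> j" and uv: "(i, a, s) \<in> E" "(j, b, t) \<notin> E" for i j a s b t
  proof -
    have "j < m" using uv(2) m up_mono by (metis le0 not_less)
    then have 1: "\<forall>p\<in>row_pair i j ` (cells j - {}). c p = 0"
      and 2: "\<forall>p\<in>column_pair i j ` (cells i - beyond j). c p = 0"
      using vanish \<open>i \<le> j\<close> unfolding test_pairs_def by auto
    show ?thesis
    proof (cases "a \<le> b")
      case True
      have "c ((i, a', ht i a'), (j, b', t')) = 0"
        if "a' \<le> b'" "(j, b', t') \<notin> E" "(j, Suc b', t') \<in> E" for a' b' t'
        using row_pair_base[OF 1 that] by simp
      from slide_right_down[OF c this True uv] show ?thesis by simp
    next
      case False
      then have "b < a" by simp
      have "c ((i, Suc a', s'), (j, b', t')) = 0"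
        if h: "b' \<le> a'" "(i, a', s') \<notin> E" "(i, Suc a', s') \<in> E" "(j, b', t') \<notin> E"
          "(j, b', Suc t') \<in> E" for a' b' s' t'
      proof (rule column_pair_base[OF 2 h])
        \<comment> \<open>The column of \<open>v\<close> in slice \<open>j\<close> contains
          \<open>v\<close>, so it is not empty.\<close>
        show "(b', s') \<notin> beyond j" using up_mono[of j b' 0 j b' t'] h(4) by (auto simp: beyond_def)
      qed
      from slide_left_up[OF c this \<open>b < a\<close> uv] show ?thesis by simp
    qed
  qed
  have upper: "c ((i, a, s), (j, b, t)) = 0"
    if "j < i" "(i, a, s) \<in> E" "(j, b, t) \<notin> E" for i j a s b t
    using that
  proof (induction j arbitrary: i a s b t rule: less_induct)
    case (less j)
    note IH = less.IH
    \<comment> \<open>Here \<open>u\<close> is x times a monomial of \<open>I\<close>: both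
      exponents step one slice down to the induction hypothesis, or \<open>j = 0\<close> and the
      coefficient vanishes.\<close>
    have prev: "c ((Suc i, a, s), (j, b, t)) = 0"
      if "j \<le> i" "(i, a, s) \<in> E" "(j, b, t) \<notin> E" for i a s b t
    proof (cases j)
      case 0
      with that hom_table_shift(4)[OF c that(2)] show ?thesis by simp
    next
      case (Suc j')
      with that(3) have "(j', b, t) \<notin> E" using up_mono by (metis le_refl lessI less_imp_le)
      with Suc that hom_table_shift(1)[OF c that(2)] IH[of j' i a s b t] show ?thesis by simp
    qed
    obtain i' where i': "i = Suc i'" "j \<le> i'" using less.prems(1) by (cases i) auto
    show ?case
    proof (cases "i' < m")
      case False
      \<comment> \<open>From slice \<open>m\<close> on, every monomial lies in
        \<open>I\<close>.\<close>
      then have "(i', a, s) \<in> E" using m up_mono by (metis le0 not_less)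
      with prev i' less.prems show ?thesis by simp
    next
      case True
      then have 1: "\<forall>p\<in>row_pair i j ` (cells j - beyond i'). c p = 0"
        and 2: "\<forall>p\<in>column_pair i j ` (cells i - {}). c p = 0"
        using vanish i' unfolding test_pairs_def by auto
      show ?thesis
      proof (cases "a \<le> b")
        case True
        have "c ((i, a', ht i a'), (j, b', t')) = 0"
          if "a' \<le> b'" "(j, b', t') \<notin> E" "(j, Suc b', t') \<in> E" for a' b' t'
        proof (cases "(i', a', 0) \<in> E")
          case True
          \<comment> \<open>These are the row pairs left out of \<open>test_pairs\<close>;
            \<open>prev\<close> handles them.\<close>
          then have "(i', a', ht i a') \<in> E" by (rule up_mono) auto
          with prev i' that show ?thesis by simp
        next
          case False
          with row_pair_base[OF 1 that] show ?thesis by (simp add: beyond_def)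
        qed
        from slide_right_down[OF c this True less.prems(2,3)] show ?thesis by simp
      next
        case False
        then have "b < a" by simp
        have "c ((i, Suc a', s'), (j, b', t')) = 0"
          if h: "b' \<le> a'" "(i, a', s') \<notin> E" "(i, Suc a', s') \<in> E" "(j, b', t') \<notin> E"
            "(j, b', Suc t') \<in> E" for a' b' s' t'
          using column_pair_base[OF 2 h] by simp
        from slide_left_up[OF c this \<open>b < a\<close> less.prems(2,3)] show ?thesis by simp
      qed
    qed
  qed
  obtain i a s j b t where "u = (i, a, s)" "v = (j, b, t)" by (cases u; cases v) auto
  then show ?thesis using lower upper assms(4,5) by (cases "i \<le> j") auto
qed

end

section \<open>Counting the test pairs\<close>

text \<open>For \<open>i < m\<close>, \<open>L i\<close> occurs with weight 2(m - i) from the first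
  term, i + 1 from the second and i from the third, in total 2m + 1. The boundary term
  \<open>m * L m\<close> disappears once slice \<open>m\<close> has no cells.\<close>

lemma sum_triangle_weights:
  fixes L :: "nat \<Rightarrow> nat"
  shows "(\<Sum>j<m. \<Sum>i\<le>j. 2 * L i + L j + L (Suc j)) = (2 * m + 1) * (\<Sum>i<m. L i) + m * L m"
proof (induction m)
  case (Suc m)
  have "(\<Sum>i\<le>m. 2 * L i + L m + L (Suc m)) = 2 * (\<Sum>i<m. L i) + 2 * L m + Suc m * (L m + L (Suc m))"
    by (simp add: sum.distrib sum_distrib_left lessThan_Suc_atMost[symmetric] algebra_simps)
  with Suc.IH show ?case by (simp add: algebra_simps)
qed simp

lemma sum_choose_triangle: "(\<Sum>i<n. Suc i choose r) + (0 choose r) = Suc n choose Suc r"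
  by (induction n) auto

lemma sum_Suc_diff_choose: "(\<Sum>i\<le>j. Suc (j - i) choose 2) = (j + 2) choose 3"
proof -
  have "(\<Sum>i\<le>j. Suc (j - i) choose 2) = (\<Sum>i<Suc j. Suc i choose 2)"
    using sum.nat_diff_reindex[of "\<lambda>i. Suc i choose 2" "Suc j"]
    by (simp add: lessThan_Suc_atMost)
  also have "\<dots> = (j + 2) choose 3"
    using sum_choose_triangle[where n = "Suc j" and r = 2] by (simp add: numeral_3_eq_3 numeral_2_eq_2)
  finally show ?thesis .
qed

context artinian_exponents
begin

lemma finite_cells: "finite (cells i)"
proof (rule finite_imageD[of "Pair i"])
  show "finite (Pair i ` cells i)"
    by (rule Finite_Set.finite_subset[OF _ finite_compl]) (auto simp: cells_def)
qed (simp add: inj_on_def)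

lemma card_compl:
  assumes "(m, 0, 0) \<in> E"
  shows "card (- E) = (\<Sum>i<m. card (cells i))" "cells m = {}"
proof -
  have "i < m" if "(i, y, z) \<notin> E" for i y z
    using that assms up_mono by (metis le0 not_less)
  then have "- E = Sigma {..<m} cells" by (auto simp: cells_def)
  then show "card (- E) = (\<Sum>i<m. card (cells i))" using finite_cells by simp
  show "cells m = {}" using up_mono[OF assms] by (auto simp: cells_def)
qed

lemma finite_test_pairs: "finite (test_pairs m)"
  unfolding test_pairs_def using finite_cells by blast

text \<open>For each \<open>i \<le> j\<close>, two of the four families are indexed by
  \<open>cells i - beyond j\<close>; this saves twice the size of
  \<open>cells i \<inter> beyond j\<close> against the weights of
  \<open>sum_triangle_weights\<close>.\<close>

lemma card_test_pairs:
  assumes m: "(m, 0, 0) \<in> E"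
  shows "card (test_pairs m) + 2 * (\<Sum>j<m. \<Sum>i\<le>j. card (cells i \<inter> beyond j)) \<le> (2 * m + 1) * card (- E)"
proof -
  have piece: "card ((row_pair i j ` cells j \<union> column_pair i j ` (cells i - beyond j)) \<union>
     (row_pair (Suc j) i ` (cells i - beyond j) \<union> column_pair (Suc j) i ` cells (Suc j)))
     + 2 * card (cells i \<inter> beyond j) \<le> 2 * card (cells i) + card (cells j) + card (cells (Suc j))"
    (is "card ((?A \<union> ?B) \<union> (?C \<union> ?D)) + _ \<le> _") for i j
  proof -
    have "card ((?A \<union> ?B) \<union> (?C \<union> ?D)) \<le> card ?A + card ?B + (card ?C + card ?D)"
      by (intro order_trans[OF card_Un_le] add_mono card_Un_le)
    also have "\<dots> \<le> card (cells j) + card (cells i - beyond j) + (card (cells i - beyond j) + card (cells (Suc j)))"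
      by (intro add_mono card_image_le finite_Diff finite_cells)
    also have "card (cells i) = card (cells i \<inter> beyond j) + card (cells i - beyond j)"
      using finite_cells by (metis card_Int_Diff)
    ultimately show ?thesis by simp
  qed
  have "card (test_pairs m) \<le> (\<Sum>j<m. \<Sum>i\<le>j. card ((row_pair i j ` cells j \<union> column_pair i j ` (cells i - beyond j)) \<union>
     (row_pair (Suc j) i ` (cells i - beyond j) \<union> column_pair (Suc j) i ` cells (Suc j))))"
    unfolding test_pairs_def by (intro order_trans[OF card_UN_le] sum_mono card_UN_le) auto
  then have "card (test_pairs m) + 2 * (\<Sum>j<m. \<Sum>i\<le>j. card (cells i \<inter> beyond j)) \<le>
    (\<Sum>j<m. \<Sum>i\<le>j. card ((row_pair i j ` cells j \<union> column_pair i j ` (cells i - beyond j)) \<union>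
     (row_pair (Suc j) i ` (cells i - beyond j) \<union> column_pair (Suc j) i ` cells (Suc j)))
      + 2 * card (cells i \<inter> beyond j))"
    by (simp add: sum.distrib sum_distrib_left)
  also have "\<dots> \<le> (\<Sum>j<m. \<Sum>i\<le>j. 2 * card (cells i) + card (cells j) + card (cells (Suc j)))"
    by (intro sum_mono piece)
  also have "\<dots> = (2 * m + 1) * card (- E)"
    unfolding sum_triangle_weights[where L = "\<lambda>i. card (cells i)"] using card_compl[OF m] by simp
  finally show ?thesis .
qed

text \<open>The index sets guarantee nonempty rows and columns, so that \<open>wd - 1\<close> and
  \<open>ht - 1\<close> point to their last cells.\<close>

lemma test_pairs_subset: "test_pairs m \<subseteq> E \<times> - E"
proof -
  have 1: "(i, a, ht i a) \<in> E" "(i, wd i s, s) \<in> E" for i a s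
    using ht_le_iff wd_le_iff by blast+
  have 2: "(j, wd j t - 1, t) \<notin> E" if "(j, a, t) \<notin> E" for j a t
    using that wd_le_iff[of j t] by (metis One_nat_def Suc_pred diff_le_self le_0_eq not_less_eq_eq order_refl zero_less_iff_neq_zero le0)
  have 3: "(j, b, ht j b - 1) \<notin> E" if "(j, b, 0) \<notin> E" for j b
    using that ht_le_iff[of j b] by (metis One_nat_def Suc_pred diff_le_self le_0_eq not_less_eq_eq order_refl zero_less_iff_neq_zero le0)
  \<comment> \<open>A cell in column \<open>b\<close> of slice \<open>Suc j\<close> forces column
    \<open>b\<close> of the earlier slice \<open>i\<close> to be nonempty.\<close>
  have 4: "(i, b, ht i b - 1) \<notin> E" if "(Suc j, b, s) \<notin> E" "i \<le> j" for i j b s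
    using that up_mono by (intro 3) (meson le0 le_SucI le_refl)
  show ?thesis
    unfolding test_pairs_def
    by (auto simp: row_pair_def column_pair_def cells_def beyond_def intro: 1 simp flip: One_nat_def)
      (use 2 3 4 in blast)+
qed

lemma tangent_dim_bound:
  assumes "(m, 0, 0) \<in> E"
  shows "fin_dim\<^sub>C (complex_space H)"
    "tangent_dim I + 2 * (\<Sum>j<m. \<Sum>i\<le>j. card (cells i \<inter> beyond j)) \<le> (2 * m + 1) * card (- E)"
proof -
  note bound = tangent_dim_le[OF finite_test_pairs test_pairs_subset, of m]
  show "fin_dim\<^sub>C (complex_space H)"
    by (rule bound(1)) (rule test_pairs_determine[OF _ _ assms])
  have "tangent_dim I \<le> card (test_pairs m)"
    by (rule bound(2)) (rule test_pairs_determine[OF _ _ assms])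
  then show "tangent_dim I + 2 * (\<Sum>j<m. \<Sum>i\<le>j. card (cells i \<inter> beyond j)) \<le> (2 * m + 1) * card (- E)"
    using card_test_pairs[OF assms] by linarith
qed

end

section \<open>Borel exchange and the size of the overlaps\<close>

locale borel_exponents = artinian_exponents +
  assumes borel_yx: "(i, Suc a, s) \<in> E \<Longrightarrow> (Suc i, a, s) \<in> E"
    and borel_zy: "(i, a, Suc s) \<in> E \<Longrightarrow> (i, Suc a, s) \<in> E"
begin

lemma borel_yx_iter: "(i, a + r, s) \<in> E \<Longrightarrow> (i + r, a, s) \<in> E"
  by (induction r arbitrary: i) (auto, metis add_Suc borel_yx)

lemma borel_zy_iter: "(i, a, s + r) \<in> E \<Longrightarrow> (i, a + r, s) \<in> E"
  by (induction r arbitrary: a) (auto, metis add_Suc borel_zy)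

text \<open>Let y^P be the pure power in slice \<open>i\<close>. The points
  \<open>(P - r, z)\<close> with \<open>z < r \<le> j - i\<close> form a triangle. They are cells of
  slice \<open>i\<close>, since trading z for y would otherwise give a smaller pure power; trading y
  for x puts their columns beyond slice \<open>j\<close>.\<close>

lemma card_cells_beyond:
  assumes "i \<le> j" "\<And>n. n < j \<Longrightarrow> (n, 0, 0) \<notin> E"
  shows "Suc (j - i) choose 2 \<le> card (cells i \<inter> beyond j)"
proof -
  define P where "P = wd i 0"
  have P: "(i, P, 0) \<in> E" using wd_le_iff[of i 0 P] by (simp add: P_def)
  \<comment> \<open>Trading all of y^P for x puts x^(i + P) in \<open>I\<close>, so
    \<open>i + P\<close> is at least \<open>j\<close>.\<close>
  with borel_yx_iter[of i 0 P 0] assms(2)[of "i + P"] have "j - i \<le> P" by fastforce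
  define T where "T = (SIGMA r:{1..j - i}. {..<r})"
  have "card T = Suc (j - i) choose 2"
    using gauss_sum_nat[of "j - i"] by (simp add: T_def choose_two sum.atLeast_Suc_atMost[of 0])
  moreover have "inj_on (\<lambda>(r, z). (P - r, z)) T"
    using \<open>j - i \<le> P\<close> by (auto simp: inj_on_def T_def)
  moreover have "(\<lambda>(r, z). (P - r, z)) ` T \<subseteq> cells i \<inter> beyond j"
  proof
    fix p assume "p \<in> (\<lambda>(r, z). (P - r, z)) ` T"
    then obtain r z where p: "p = (P - r, z)" and rz: "r \<le> j - i" "z < r" by (auto simp: T_def)
    have "(i, P - r, z) \<notin> E"
    proof
      assume "(i, P - r, z) \<in> E"
      then have "(i, P - r + z, 0) \<in> E" using borel_zy_iter[of i "P - r" 0 z] by simp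
      then have "P \<le> P - r + z" by (simp add: P_def wd_le_iff)
      with rz \<open>j - i \<le> P\<close> show False by simp
    qed
    moreover have "(j, P - (j - i), 0) \<in> E"
      using borel_yx_iter[of i "P - (j - i)" "j - i" 0] P \<open>j - i \<le> P\<close> assms(1) by simp
    then have "(j, P - r, 0) \<in> E" by (rule up_mono) (use rz in auto)
    ultimately show "p \<in> cells i \<inter> beyond j"
      by (simp add: p cells_def beyond_def)
  qed
  ultimately show ?thesis
    using card_inj_on_le[of "\<lambda>(r, z). (P - r, z)" T "cells i \<inter> beyond j"] finite_cells by simp
qed

text \<open>Summing the triangles over all \<open>i \<le> j < m\<close> gives the first bound; the
  triangles for \<open>j = m\<close> alone already lie in the slices and give the second.\<close>

lemma borel_tangent_dim_bound:
  assumes m: "(m, 0, 0) \<in> E" "\<And>n. n < m \<Longrightarrow> (n, 0, 0) \<notin> E"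
  shows "tangent_dim I + 2 * ((m + 2) choose 4) \<le> (2 * m + 1) * card (- E)"
    and "(m + 2) choose 3 \<le> card (- E)"
proof -
  have "(m + 2) choose 4 = (\<Sum>j<m. (j + 2) choose 3)"
    by (induction m) (auto simp: numeral_eq_Suc)
  also have "\<dots> = (\<Sum>j<m. \<Sum>i\<le>j. Suc (j - i) choose 2)"
    by (simp only: sum_Suc_diff_choose)
  also have "\<dots> \<le> (\<Sum>j<m. \<Sum>i\<le>j. card (cells i \<inter> beyond j))"
    by (intro sum_mono card_cells_beyond m(2)) auto
  finally show "tangent_dim I + 2 * ((m + 2) choose 4) \<le> (2 * m + 1) * card (- E)"
    using tangent_dim_bound(2)[OF m(1)] by linarith
  have "(m + 2) choose 3 = (\<Sum>i\<le>m. Suc (m - i) choose 2)" by (simp only: sum_Suc_diff_choose)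
  \<comment> \<open>The term at \<open>i = m\<close> is 1 choose 2, which is zero.\<close>
  also have "\<dots> = (\<Sum>i<m. Suc (m - i) choose 2)"
    by (simp add: lessThan_Suc_atMost[symmetric])
  also have "\<dots> \<le> (\<Sum>i<m. card (cells i))"
    by (intro sum_mono order_trans[OF card_cells_beyond card_mono] m(2)) (auto intro: finite_cells)
  finally show "(m + 2) choose 3 \<le> card (- E)" using card_compl[OF m(1)] by simp
qed

end

section \<open>Exponents of Borel-fixed ideals\<close>

text \<open>\<open>mono_ideal E\<close> is an ideal containing the generating monomials, hence
  contains \<open>I\<close>; conversely its elements are sums of scalar multiples of monomials of
  \<open>I\<close>.\<close>

lemma monomial_ideal_eq:
  assumes "ideal I R3" "monomial_ideal I"
  defines "E \<equiv> {u. Poly_Mapping.single u 1 \<in> I}"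
  shows "monomial_exponents E" "I = mono_ideal E"
proof -
  interpret ideal I R3 by fact
  show up: "monomial_exponents E"
  proof
    fix u e assume "u \<in> E"
    then show "e + u \<in> E"
      using I_l_closed[of "Poly_Mapping.single u 1" "Poly_Mapping.single e 1"]
      by (simp add: E_def mult_single)
  qed
  obtain S where S: "S \<subseteq> monomials3" "I = Idl\<^bsub>R3\<^esub> S"
    using assms(2) unfolding monomial_ideal_def by blast
  have "S \<subseteq> I" unfolding S(2) genideal_def by blast
  have "S \<subseteq> mono_ideal E"
  proof
    fix f assume f: "f \<in> S"
    then obtain u where u: "f = Poly_Mapping.single u 1"
      using S(1) unfolding monomials3_def by (auto simp: monomial3_eq_single)
    with f \<open>S \<subseteq> I\<close> show "f \<in> mono_ideal E" by (auto simp: E_def intro: single_in_mono_ideal)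
  qed
  then have "I \<subseteq> mono_ideal E"
    using monomial_exponents.ideal_I[OF up] unfolding S(2) genideal_def by blast
  moreover have "mono_ideal E \<subseteq> I"
  proof
    fix f assume f: "f \<in> mono_ideal E"
    have "(\<Sum>u\<in>Poly_Mapping.keys f. Poly_Mapping.single u (Poly_Mapping.lookup f u)) \<in> I"
    proof (rule sum_in_ideal_R3[OF assms(1)])
      fix u assume "u \<in> Poly_Mapping.keys f"
      with f have "Poly_Mapping.single u 1 \<in> I" by (auto simp: mono_ideal_def E_def)
      then show "Poly_Mapping.single u (Poly_Mapping.lookup f u) \<in> I"
        using I_l_closed[of "Poly_Mapping.single u 1" "const3 (Poly_Mapping.lookup f u)"]
        by (simp add: const3_def mult_single zero_prod_def[symmetric])
    qed
    then show "f \<in> I" by (simp add: poly_mapping_eq_sum_single[symmetric])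
  qed
  ultimately show "I = mono_ideal E" by blast
qed

lemma single_dvd_single_iff:
  "Poly_Mapping.single v (1::complex) dvd Poly_Mapping.single u 1 \<longleftrightarrow> (\<exists>e. u = v + e)"
  for u v :: "nat \<times> nat \<times> nat"
proof
  assume "Poly_Mapping.single v (1::complex) dvd Poly_Mapping.single u 1"
  then obtain f where "Poly_Mapping.single u 1 = Poly_Mapping.single v (1::complex) * f" ..
  then have "Poly_Mapping.lookup (Poly_Mapping.single v (1::complex) * f) u = 1"
    by (metis lookup_single_eq)
  then show "\<exists>e. u = v + e" using lookup_single_times_eq_0[of u v 1 f] by auto
next
  assume "\<exists>e. u = v + e"
  then obtain e where "u = v + e" by blast
  then have "Poly_Mapping.single u 1 = Poly_Mapping.single v (1::complex) * Poly_Mapping.single e 1"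
    by (simp add: mult_single)
  then show "Poly_Mapping.single v (1::complex) dvd Poly_Mapping.single u 1" by simp
qed

context monomial_exponents
begin

lemma single_in_mono_ideal_iff: "Poly_Mapping.single u 1 \<in> I \<longleftrightarrow> u \<in> E"
  by (auto simp: mono_ideal_def)

lemma min_gens_iff:
  "Poly_Mapping.single u 1 \<in> min_gens I \<longleftrightarrow> u \<in> E \<and> (\<forall>v\<in>E. (\<exists>e. u = v + e) \<longrightarrow> v = u)"
proof -
  have M: "monomials3 = range (\<lambda>v. Poly_Mapping.single v 1)"
    by (auto simp: monomials3_def monomial3_eq_single)
  have inj: "Poly_Mapping.single v (1::complex) = Poly_Mapping.single u 1 \<longleftrightarrow> v = u" for v
    by (metis keys_single singleton_inject zero_neq_one)
  have "Poly_Mapping.single u 1 \<in> min_gens I \<longleftrightarrow> Poly_Mapping.single u 1 \<in> I \<and>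
    (\<forall>v. Poly_Mapping.single v 1 \<in> I \<longrightarrow> Poly_Mapping.single v (1::complex) dvd Poly_Mapping.single u 1 \<longrightarrow>
      Poly_Mapping.single v (1::complex) = Poly_Mapping.single u 1)"
    unfolding min_gens_def M by blast
  then show ?thesis
    unfolding single_in_mono_ideal_iff single_dvd_single_iff inj by blast
qed

lemma min_gen_below:
  assumes "u \<in> E"
  obtains v e where "Poly_Mapping.single v 1 \<in> min_gens I" "u = v + e"
proof -
  have "\<exists>v e. Poly_Mapping.single v 1 \<in> min_gens I \<and> u = v + e"
    using assms
  proof (induction "case u of (a, b, c) \<Rightarrow> a + b + c" arbitrary: u rule: less_induct)
    case less
    show ?case
    proof (cases "Poly_Mapping.single u 1 \<in> min_gens I")
      case True
      then show ?thesis by (intro exI[of _ u] exI[of _ 0]) auto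
    next
      case False
      then obtain w e where w: "w \<in> E" "u = w + e" "w \<noteq> u" using less.prems
        unfolding min_gens_iff by blast
      then have "(case w of (a, b, c) \<Rightarrow> a + b + c) < (case u of (a, b, c) \<Rightarrow> a + b + c)"
        by (cases w; cases e) auto
      from less.hyps[OF this w(1)] w(2) show ?thesis by (metis add.assoc)
    qed
  qed
  with that show thesis by blast
qed

text \<open>Extends the exchange from minimal generators to all of \<open>E\<close>. Take a minimal
  generator dividing the monomial: if it has the full exponent of the variable removed, exchange
  inside it; otherwise it already divides the exchanged monomial.\<close>

lemma borel_fixed_exponents:
  assumes "borel_fixed I"
  shows "(i, Suc a, s) \<in> E \<Longrightarrow> (Suc i, a, s) \<in> E"
    and "(i, a, Suc s) \<in> E \<Longrightarrow> (i, Suc a, s) \<in> E"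
proof -
  have prods: "var_x * Poly_Mapping.single (i, a, s) 1 = Poly_Mapping.single (Suc i, a, s) 1"
    "var_y * Poly_Mapping.single (i, a, s) 1 = Poly_Mapping.single (i, Suc a, s) 1"
    "var_z * Poly_Mapping.single (i, a, s) 1 = Poly_Mapping.single (i, a, Suc s) 1" for i a s
    by (simp_all add: var_x_def var_y_def var_z_def mult_single)
  have gen: "(i, Suc a, s) \<in> E \<and> (Suc i, a, s) \<in> E" if "Poly_Mapping.single (i, a, Suc s) 1 \<in> min_gens I" for i a s
    using that assms prods(3)[of i a s] unfolding borel_fixed_def
    by (metis prods(1,2) single_in_mono_ideal_iff)
  have gen': "(Suc i, a, s) \<in> E" if "Poly_Mapping.single (i, Suc a, s) 1 \<in> min_gens I" for i a s
    using that assms prods(2)[of i a s] unfolding borel_fixed_def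
    by (metis prods(1) single_in_mono_ideal_iff)
  have min_in: "v \<in> E" if "Poly_Mapping.single v 1 \<in> min_gens I" for v
    using that by (simp add: min_gens_iff)
  show "(Suc i, a, s) \<in> E" if u: "(i, Suc a, s) \<in> E"
  proof -
    obtain i' a' s' e where v: "Poly_Mapping.single (i', a', s') 1 \<in> min_gens I" "(i, Suc a, s) = (i', a', s') + e"
      using min_gen_below[OF u] by (metis prod_cases3)
    then have le: "i' \<le> i" "a' \<le> Suc a" "s' \<le> s" by (cases e; auto)+
    show ?thesis
    proof (cases "a' = Suc a")
      case True
      with gen'[of i' a s'] v(1) have "(Suc i', a, s') \<in> E" by simp
      then show ?thesis by (rule up_mono) (use le in auto)
    next
      case False
      from min_in[OF v(1)] show ?thesis by (rule up_mono) (use le False in auto)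
    qed
  qed
  show "(i, Suc a, s) \<in> E" if u: "(i, a, Suc s) \<in> E"
  proof -
    obtain i' a' s' e where v: "Poly_Mapping.single (i', a', s') 1 \<in> min_gens I" "(i, a, Suc s) = (i', a', s') + e"
      using min_gen_below[OF u] by (metis prod_cases3)
    then have le: "i' \<le> i" "a' \<le> a" "s' \<le> Suc s" by (cases e; auto)+
    show ?thesis
    proof (cases "s' = Suc s")
      case True
      with gen[of i' a' s] v(1) have "(i', Suc a', s) \<in> E" by simp
      then show ?thesis by (rule up_mono) (use le in auto)
    next
      case False
      from min_in[OF v(1)] show ?thesis by (rule up_mono) (use le False in auto)
    qed
  qed
qed

end

section \<open>Powers of the maximal ideal\<close>

definition of_degree :: "nat \<Rightarrow> (nat \<times> nat \<times> nat) set" where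
  "of_degree n = {(a, b, c). a + b + c = n}"

lemma card_of_degree: "finite (of_degree n)" "card (of_degree n) = (n + 2) choose 2"
proof -
  have eq: "of_degree n = (\<lambda>(a, b). (a, b, n - a - b)) ` (SIGMA a:{..n}. {..n - a})"
    by (force simp: of_degree_def)
  show "finite (of_degree n)" unfolding eq by auto
  have "card (of_degree n) = (\<Sum>a\<le>n. Suc (n - a))"
    unfolding eq by (subst card_image) (auto simp: inj_on_def)
  also have "\<dots> = (\<Sum>a<Suc n. Suc a)"
    using sum.nat_diff_reindex[of Suc "Suc n"] by (simp add: lessThan_Suc_atMost)
  also have "\<dots> = (n + 2) choose 2"
    using sum_choose_triangle[where n = "Suc n" and r = 1] by (simp add: numeral_2_eq_2)
  finally show "card (of_degree n) = (n + 2) choose 2" .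
qed

text \<open>The exponents of the \<open>k\<close>-th power of the maximal ideal (x, y, z).\<close>

definition degree_ge :: "nat \<Rightarrow> (nat \<times> nat \<times> nat) set" where
  "degree_ge k = {(a, b, c). k \<le> a + b + c}"

lemma card_compl_degree_ge: "finite (- degree_ge k)" "card (- degree_ge k) = (k + 2) choose 3"
proof -
  have eq: "- degree_ge k = (\<Union>n<k. of_degree n)" by (auto simp: degree_ge_def of_degree_def)
  show "finite (- degree_ge k)" unfolding eq by (auto intro: card_of_degree)
  have "card (- degree_ge k) = (\<Sum>n<k. (n + 2) choose 2)"
    unfolding eq by (subst card_UN_disjoint) (auto simp: card_of_degree, auto simp: of_degree_def)
  also have "\<dots> = (k + 2) choose 3"
    by (induction k) (auto simp: numeral_eq_Suc)
  finally show "card (- degree_ge k) = (k + 2) choose 3" .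
qed

text \<open>All monomials of degree \<open>k\<close> are minimal generators and all of degree
  \<open>k - 1\<close> lie in the socle, so every such pair contributes.\<close>

lemma tangent_dim_power_ge:
  assumes "k \<ge> 1"
  shows "((k + 2) choose 2) * ((k + 1) choose 2) \<le> tangent_dim (mono_ideal (degree_ge k))"
proof -
  interpret artinian_exponents "degree_ge k"
    by unfold_locales (simp_all only: card_compl_degree_ge, auto simp: degree_ge_def)
  let ?A = "of_degree k \<times> of_degree (k - 1)"
  have "card ?A \<le> tangent_dim (mono_ideal (degree_ge k))"
  proof (rule card_le_tangent_dim)
    show "finite ?A" using card_of_degree by blast
    show "?A \<subseteq> degree_ge k \<times> - degree_ge k"
      using assms by (auto simp: of_degree_def degree_ge_def)
    show "fin_dim\<^sub>C (complex_space H)"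
      by (rule tangent_dim_bound(1)[of k]) (simp add: degree_ge_def)
    show "w \<notin> degree_ge k" if "(u, v) \<in> ?A" "u = e + w" "e \<noteq> 0" for u v e w
      using that by (cases e; cases w) (auto simp: of_degree_def degree_ge_def zero_prod_def)
    show "e + v \<in> degree_ge k" if "(u, v) \<in> ?A" "e \<noteq> 0" for u v e
      using that by (cases e; cases v) (auto simp: of_degree_def degree_ge_def zero_prod_def)
  qed
  moreover have "k - 1 + 2 = k + 1" using assms by simp
  ultimately show ?thesis by (simp add: card_of_degree card_cartesian_product)
qed

text \<open>The upper bound at \<open>m = k\<close> equals the lower bound for the power of the
  maximal ideal. With \<open>k = n + 1\<close>, multiplying by 12 clears all denominators.\<close>

lemma choose_tangent_identity:
  "((k + 2) choose 2) * ((k + 1) choose 2) + 2 * ((k + 2) choose 4) = (2 * k + 1) * ((k + 2) choose 3)"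
proof (cases k)
  case (Suc n)
  have c2: "2 * ((N + 1) choose 2) = (N + 1) * N" for N
    using Suc_times_binomial[of 1 N] by (simp add: numeral_2_eq_2)
  have c3: "6 * ((N + 2) choose 3) = (N + 2) * (N + 1) * N" for N
  proof -
    have "3 * ((N + 2) choose 3) = (N + 2) * ((N + 1) choose 2)"
      using Suc_times_binomial[of 2 "N + 1"] by (simp add: numeral_3_eq_3 numeral_2_eq_2)
    then have "6 * ((N + 2) choose 3) = (N + 2) * (2 * ((N + 1) choose 2))" by simp
    then show ?thesis unfolding c2 by (simp only: mult.assoc)
  qed
  have c4: "24 * ((N + 3) choose 4) = (N + 3) * (N + 2) * (N + 1) * N" for N
  proof -
    have "4 * ((N + 3) choose 4) = (N + 3) * ((N + 2) choose 3)"
      using Suc_times_binomial[of 3 "N + 2"] by (simp add: eval_nat_numeral)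
    then have "24 * ((N + 3) choose 4) = (N + 3) * (6 * ((N + 2) choose 3))" by simp
    then show ?thesis unfolding c3 by (simp only: mult.assoc)
  qed
  define a b c d where "a = (k + 2) choose 2" "b = (k + 1) choose 2" "c = (k + 2) choose 3" "d = (k + 2) choose 4"
  note def = this
  have k: "k + 2 = (n + 2) + 1" "k + 1 = (n + 1) + 1" "k + 2 = (n + 1) + 2" "k + 2 = n + 3"
    by (simp_all add: Suc)
  have "2 * a = ((n + 2) + 1) * (n + 2)" unfolding def k(1) by (rule c2)
  moreover have "2 * b = ((n + 1) + 1) * (n + 1)" unfolding def k(2) by (rule c2)
  moreover have "6 * c = ((n + 1) + 2) * ((n + 1) + 1) * (n + 1)" unfolding def k(3) by (rule c3)
  moreover have "24 * d = (n + 3) * (n + 2) * (n + 1) * n" unfolding def k(4) by (rule c4)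
  moreover have "k = n + 1" by (simp add: Suc)
  ultimately have *: "2 * a = (n + 3) * (n + 2)" "2 * b = (n + 2) * (n + 1)"
    "6 * c = (n + 3) * (n + 2) * (n + 1)" "24 * d = (n + 3) * (n + 2) * (n + 1) * n" "k = n + 1"
    by (simp_all add: numeral_eq_Suc)
  have "12 * (a * b + 2 * d) = 3 * ((2 * a) * (2 * b)) + 24 * d" by (simp add: algebra_simps)
  also have "\<dots> = 2 * (2 * n + 3) * (6 * c)" unfolding *(1-4) by (simp add: algebra_simps)
  also have "\<dots> = 12 * ((2 * k + 1) * c)" unfolding *(5) by (simp add: algebra_simps)
  finally have "12 * (a * b + 2 * d) = 12 * ((2 * k + 1) * c)" .
  then show ?thesis unfolding def by simp
qed (simp add: eval_nat_numeral)

text \<open>Strict growth of (2m + 1) C(k + 2, 3) - 2 C(m + 2, 4) up to \<open>m = k\<close>: a unit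
  step of \<open>m\<close> raises C(m + 2, 4) by C(m + 2, 3), which is less than C(k + 2,
  3).\<close>

lemma choose_4_diff_less:
  assumes "m < k"
  shows "(k + 2) choose 4 < ((m + 2) choose 4) + (k - m) * ((k + 2) choose 3)"
proof -
  \<comment> \<open>The extra \<open>+ d\<close> records a gain of at least one per step and yields
    strictness.\<close>
  have "((m + d + 2) choose 4) + d \<le> ((m + 2) choose 4) + d * ((k + 2) choose 3)" if "m + d \<le> k" for d
    using that
  proof (induction d)
    case (Suc d)
    have "m + Suc d + 2 choose 4 = (m + d + 2 choose 3) + (m + d + 2 choose 4)"
      by (simp add: eval_nat_numeral)
    moreover have "(m + d + 2) choose 3 \<le> (k + 1) choose 3"
      using Suc.prems by (intro binomial_right_mono) auto
    moreover have "(k + 2) choose 3 = ((k + 1) choose 2) + ((k + 1) choose 3)"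
      by (simp add: eval_nat_numeral)
    moreover have "(k + 1) choose 2 > 0" using assms by simp
    moreover have "((m + d + 2) choose 4) + d \<le> ((m + 2) choose 4) + d * ((k + 2) choose 3)"
      using Suc by simp
    ultimately show ?case unfolding mult_Suc by linarith
  qed simp
  from this[of "k - m"] assms show ?thesis by simp
qed

theorem corollary2:
  fixes k l m1 m2 m3 :: nat and I :: "poly3 set"
  assumes "k \<ge> 1"
    and "l = (k + 2) choose 3"
    and "zero_dimensional I"
    and "borel_fixed I"
    and "has_colength I l"
    and "var_x ^ m1 \<in> min_gens I"
    and "var_y ^ m2 \<in> min_gens I"
    and "var_z ^ m3 \<in> min_gens I"
    and "\<forall>J. ideal J R3 \<and> has_colength J l \<longrightarrow> tangent_dim J \<le> tangent_dim I"
  shows "m1 = k"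
proof -
  have I: "ideal I R3" "monomial_ideal I"
    using assms(3,4) by (auto simp: zero_dimensional_def borel_fixed_def)
  define E where "E = {u. Poly_Mapping.single u (1::complex) \<in> I}"
  interpret monomial_exponents E unfolding E_def by (rule monomial_ideal_eq(1)[OF I])
  have eq: "I = mono_ideal E" unfolding E_def by (rule monomial_ideal_eq(2)[OF I])
  have powers: "var_x ^ m1 = Poly_Mapping.single (m1, 0, 0) 1"
    "var_y ^ m2 = Poly_Mapping.single (0, m2, 0) 1" "var_z ^ m3 = Poly_Mapping.single (0, 0, m3) 1"
    using monomial3_eq_single[of m1 0 0] monomial3_eq_single[of 0 m2 0] monomial3_eq_single[of 0 0 m3]
    by simp_all
  have corners: "(m1, 0, 0) \<in> E" "(0, m2, 0) \<in> E" "(0, 0, m3) \<in> E"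
    using assms(6-8) unfolding powers eq by (auto simp: min_gens_iff)
  \<comment> \<open>The pure powers confine the complement to a box.\<close>
  have "- E \<subseteq> {..m1} \<times> {..m2} \<times> {..m3}"
  proof
    fix u assume u: "u \<in> - E"
    obtain a b c where abc: "u = (a, b, c)" by (cases u)
    with u corners[THEN up_mono, of a b c] show "u \<in> {..m1} \<times> {..m2} \<times> {..m3}"
      by (cases "m1 \<le> a"; cases "m2 \<le> b"; cases "m3 \<le> c") auto
  qed
  then have fin: "finite (- E)" by (rule finite_subset) auto
  interpret borel_exponents E
    using fin borel_fixed_exponents assms(4)[unfolded eq] by unfold_locales blast+
  have minimal: "(n, 0, 0) \<notin> E" if "n < m1" for n
  proof
    assume "(n, 0, 0) \<in> E"
    moreover have "(m1, 0, 0) = (n, 0, 0) + (m1 - n, 0::nat, 0::nat)" using that by simp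
    ultimately have "(n, 0, 0) = (m1, 0::nat, 0::nat)"
      using assms(6) unfolding powers eq min_gens_iff by blast
    with that show False by simp
  qed
  have card: "card (- E) = (k + 2) choose 3"
    using has_colength_card[OF fin] assms(2,5) by (simp add: eq has_colength_def)
  note bounds = borel_tangent_dim_bound[OF corners(1) minimal, unfolded card]
  have "m1 \<le> k"
  proof (rule ccontr)
    assume "\<not> m1 \<le> k"
    then have "Suc k + 2 choose 3 \<le> m1 + 2 choose 3" by (intro binomial_right_mono) auto
    then show False using bounds(2) assms(1) by (simp add: numeral_eq_Suc)
  qed
  moreover have "\<not> m1 < k"
  proof
    assume less: "m1 < k"
    interpret power: monomial_exponents "degree_ge k"
      by unfold_locales (auto simp: degree_ge_def)
    have "has_colength (mono_ideal (degree_ge k)) l"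
      using power.has_colength_card card_compl_degree_ge assms(2) by metis
    then have "tangent_dim (mono_ideal (degree_ge k)) \<le> tangent_dim I"
      using assms(9) power.ideal_I by blast
    \<comment> \<open>Chains the lower bound for the power, maximality of \<open>I\<close> and the
      upper bound for \<open>I\<close>, with the subtracted terms moved across to stay in the
      naturals.\<close>
    then have "(2 * k + 1) * ((k + 2) choose 3) + 2 * ((m1 + 2) choose 4)
        \<le> (2 * m1 + 1) * ((k + 2) choose 3) + 2 * ((k + 2) choose 4)"
      using tangent_dim_power_ge[OF assms(1)] bounds(1) choose_tangent_identity[of k] eq by simp
    moreover have "(2 * k + 1) * ((k + 2) choose 3) =
        (2 * m1 + 1) * ((k + 2) choose 3) + 2 * ((k - m1) * ((k + 2) choose 3))"
    proof -
      obtain d where "k = m1 + d" using less less_imp_add_positive by blast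
      then show ?thesis by (simp add: algebra_simps del: binomial_Suc_Suc add_2_eq_Suc')
    qed
    ultimately show False using choose_4_diff_less[OF less] by linarith
  qed
  ultimately show ?thesis by simp
qed

end
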